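(* Let $A = K(\ell^2) + \mathbb{C} I_{\ell^2}$, the C$^*$-algebra generated by the compact operators on the separable infinite-dimensional Hilbert space $\ell^2$ and the identity operator. Then there exists a (right) Hilbert $A$-module that possesses no frames.
   Context: Hilbert $A$-modules are right modules, with $A$-valued inner product $\langle\cdot,\cdot\rangle$ that is $A$-linear in the second variable and conjugate-linear in the first. A family $\{x_j\}_{j\in J}$ of elements of a Hilbert $A$-module $X$ ($J$ an arbitrary index set) is a frame for $X$ if there are real numbers $C, D>0$ such that for every $x\in X$ $$C\,\langle x,x\rangle \;\le\; \sum_{j\in J}\langle x,x_j\rangle\langle x_j,x\rangle \;\le\; D\,\langle x,x\rangle ,$$ where the sum in the middle converges in the ultraweak topology of the enveloping von Neumann algebra $A^{**}$. *)

theory Defs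
  imports "HOL-Analysis.Analysis"
begin

section \<open>The Hilbert space of square-summable complex sequences\<close>

typedef l2 = "{x :: nat \<Rightarrow> complex. summable (\<lambda>n. (cmod (x n))\<^sup>2)}"
  morphisms coord Abs_l2
  by (rule exI[of _ "\<lambda>_. 0"]) simp

setup_lifting type_definition_l2

lemma l2_add_summable:
  fixes x y :: "nat \<Rightarrow> complex"
  assumes "summable (\<lambda>n. (cmod (x n))\<^sup>2)" "summable (\<lambda>n. (cmod (y n))\<^sup>2)"
  shows "summable (\<lambda>n. (cmod (x n + y n))\<^sup>2)"
proof (rule summable_comparison_test')
  show "summable (\<lambda>n. 2 * (cmod (x n))\<^sup>2 + 2 * (cmod (y n))\<^sup>2)"
    using assms by (intro summable_add summable_mult)
  fix n :: nat
  have "(cmod (x n + y n))\<^sup>2 \<le> (cmod (x n) + cmod (y n))\<^sup>2"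
    by (intro power_mono norm_triangle_ineq) auto
  also have "\<dots> \<le> 2 * (cmod (x n))\<^sup>2 + 2 * (cmod (y n))\<^sup>2"
    using sum_squares_bound[of "cmod (x n)" "cmod (y n)"] by (simp add: power2_sum)
  finally show "norm ((cmod (x n + y n))\<^sup>2) \<le> 2 * (cmod (x n))\<^sup>2 + 2 * (cmod (y n))\<^sup>2" by simp
qed

lemma l2_mult_summable:
  fixes x y :: "nat \<Rightarrow> complex"
  assumes "summable (\<lambda>n. (cmod (x n))\<^sup>2)" "summable (\<lambda>n. (cmod (y n))\<^sup>2)"
  shows "summable (\<lambda>n. cmod (x n) * cmod (y n))"
proof (rule summable_comparison_test')
  show "summable (\<lambda>n. (cmod (x n))\<^sup>2 + (cmod (y n))\<^sup>2)"
    using assms by (rule summable_add)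
  fix n :: nat
  show "norm (cmod (x n) * cmod (y n)) \<le> (cmod (x n))\<^sup>2 + (cmod (y n))\<^sup>2"
    using sum_squares_bound[of "cmod (x n)" "cmod (y n)"]
      mult_nonneg_nonneg[OF norm_ge_zero[of "x n"] norm_ge_zero[of "y n"]]
    unfolding real_norm_def by linarith
qed

instantiation l2 :: real_vector
begin
lift_definition zero_l2 :: l2 is "\<lambda>_. 0" by simp
lift_definition plus_l2 :: "l2 \<Rightarrow> l2 \<Rightarrow> l2" is "\<lambda>x y n. x n + y n"
  by (rule l2_add_summable)
lift_definition uminus_l2 :: "l2 \<Rightarrow> l2" is "\<lambda>x n. - x n" by simp
lift_definition minus_l2 :: "l2 \<Rightarrow> l2 \<Rightarrow> l2" is "\<lambda>x y n. x n - y n"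
  subgoal for x y using l2_add_summable[of x "\<lambda>n. - y n"] by simp
  done
lift_definition scaleR_l2 :: "real \<Rightarrow> l2 \<Rightarrow> l2" is "\<lambda>r x n. r *\<^sub>R x n"
  by (simp add: power_mult_distrib summable_mult)
instance
  by standard (transfer; auto simp: fun_eq_iff algebra_simps)+
end

instantiation l2 :: real_inner
begin
definition inner_l2 :: "l2 \<Rightarrow> l2 \<Rightarrow> real" where
  "inner_l2 x y = (\<Sum>n. coord x n \<bullet> coord y n)"
definition norm_l2 :: "l2 \<Rightarrow> real" where "norm_l2 x = sqrt (x \<bullet> x)"
definition sgn_l2 :: "l2 \<Rightarrow> l2" where "sgn_l2 x = x /\<^sub>R norm x"
definition dist_l2 :: "l2 \<Rightarrow> l2 \<Rightarrow> real" where "dist_l2 x y = norm (x - y)"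
definition uniformity_l2 :: "(l2 \<times> l2) filter" where
  "uniformity_l2 = (INF e\<in>{0<..}. principal {(x, y). dist x y < e})"
definition open_l2 :: "l2 set \<Rightarrow> bool" where
  "open_l2 U = (\<forall>x\<in>U. eventually (\<lambda>(x', y). x' = x \<longrightarrow> y \<in> U) uniformity)"
instance
proof
  have sm: "summable (\<lambda>n. coord x n \<bullet> coord y n)" for x y :: l2
    by (rule summable_comparison_test'[OF l2_mult_summable[of "coord x" "coord y"]])
      (use coord[of x] coord[of y] in \<open>auto simp: Cauchy_Schwarz_ineq2\<close>)
  show "dist x y = norm (x - y)" for x y :: l2 by (simp add: dist_l2_def)
  show "sgn x = x /\<^sub>R norm x" for x :: l2 by (simp add: sgn_l2_def)
  show "uniformity = (INF e\<in>{0<..}. principal {(x :: l2, y). dist x y < e})"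
    by (simp add: uniformity_l2_def)
  show "open U = (\<forall>x\<in>U. eventually (\<lambda>(x', y). x' = x \<longrightarrow> y \<in> U) uniformity)" for U :: "l2 set"
    by (simp add: open_l2_def)
  show "x \<bullet> y = y \<bullet> x" for x y :: l2 by (simp add: inner_l2_def inner_commute)
  show "(x + y) \<bullet> z = x \<bullet> z + y \<bullet> z" for x y z :: l2
    unfolding inner_l2_def plus_l2.rep_eq inner_add_left by (rule suminf_add[OF sm sm, symmetric])
  show "(r *\<^sub>R x) \<bullet> y = r * (x \<bullet> y)" for r and x y :: l2
    unfolding inner_l2_def scaleR_l2.rep_eq inner_scaleR_left by (rule suminf_mult[OF sm])
  show "0 \<le> x \<bullet> x" for x :: l2
    unfolding inner_l2_def by (intro suminf_nonneg sm) simp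
  show "(x \<bullet> x = 0) = (x = 0)" for x :: l2
    unfolding inner_l2_def
    by (subst suminf_eq_zero_iff[OF sm]) (auto simp: coord_inject[symmetric] zero_l2.rep_eq fun_eq_iff)
  show "norm x = sqrt (x \<bullet> x)" for x :: l2 by (simp add: norm_l2_def)
qed
end

lift_definition cscale :: "complex \<Rightarrow> l2 \<Rightarrow> l2" is "\<lambda>c x n. c * x n"
  by (simp add: norm_mult power_mult_distrib summable_mult)

text \<open>The complex inner product, conjugate-linear in the first variable; the real inner product
  above, which induces the norm, is its real part.\<close>

definition cinner :: "l2 \<Rightarrow> l2 \<Rightarrow> complex" where
  "cinner x y = (\<Sum>n. cnj (coord x n) * coord y n)"

lemma summable_cinner: "summable (\<lambda>n. cnj (coord x n) * coord y n)"
  by (rule summable_comparison_test'[OF l2_mult_summable[of "coord x" "coord y"]])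
    (use coord[of x] coord[of y] in \<open>auto simp: norm_mult\<close>)

lemma Re_cinner: "Re (cinner x y) = x \<bullet> y"
  unfolding cinner_def inner_l2_def
  by (subst Re_suminf[OF summable_cinner]) (simp add: inner_complex_def)

lemma cinner_commute: "cinner y x = cnj (cinner x y)"
  using sums_unique[OF iffD2[OF sums_cnj summable_sums[OF summable_cinner[of x y]]]]
  unfolding cinner_def by (simp add: mult.commute)

lemma cinner_add_right: "cinner x (y + z) = cinner x y + cinner x z"
  unfolding cinner_def plus_l2.rep_eq distrib_left
  by (rule suminf_add[OF summable_cinner summable_cinner, symmetric])

lemma cinner_cscale_right: "cinner x (cscale c y) = c * cinner x y"
  unfolding cinner_def cscale.rep_eq mult.left_commute[of "cnj _" c]
  by (rule suminf_mult[OF summable_cinner])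

lemma cinner_add_left: "cinner (x + y) z = cinner x z + cinner y z"
  using cinner_commute cinner_add_right by (metis complex_cnj_add)

lemma cinner_cscale_left: "cinner (cscale c x) y = cnj c * cinner x y"
  using cinner_commute cinner_cscale_right by (metis complex_cnj_mult)

lemma cinner_self: "cinner x x = complex_of_real ((norm x)\<^sup>2)"
proof -
  have "Im (cinner x x) = 0"
    using cinner_commute[of x x] by (simp add: complex_eq_iff)
  then show ?thesis by (simp add: complex_eq_iff Re_cinner dot_square_norm)
qed

lemma cscale_of_real: "cscale (complex_of_real r) x = r *\<^sub>R x"
  by transfer (simp add: scaleR_conv_of_real)

lemma cinner_diff_right: "cinner x (y - z) = cinner x y - cinner x z"
  using cinner_add_right[of x "y - z" z] by simp

lemma cinner_scaleR_right: "cinner x (r *\<^sub>R y) = of_real r * cinner x y"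
  by (metis cinner_cscale_right cscale_of_real)

lemma cinner_eqI: "(\<And>x. cinner x y = cinner x z) \<Longrightarrow> y = z"
  using cinner_self[of "y - z"] cinner_diff_right[of "y - z" y z] by simp

lemma norm_cscale: "norm (cscale c x) = cmod c * norm x"
proof -
  have "complex_of_real ((norm (cscale c x))\<^sup>2) = (c * cnj c) * of_real ((norm x)\<^sup>2)"
    unfolding cinner_self[symmetric] cinner_cscale_left cinner_cscale_right by (simp only: mult_ac)
  also have "\<dots> = of_real ((cmod c)\<^sup>2) * of_real ((norm x)\<^sup>2)"
    by (simp only: complex_norm_square)
  also have "\<dots> = of_real ((cmod c * norm x)\<^sup>2)"
    by (simp only: power_mult_distrib of_real_mult)
  finally have "(norm (cscale c x))\<^sup>2 = (cmod c * norm x)\<^sup>2"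
    unfolding of_real_eq_iff .
  then show ?thesis by (rule power2_eq_imp_eq) simp_all
qed

lemma cinner_Cauchy_Schwarz: "cmod (cinner x y) \<le> norm x * norm y"
proof (cases "cinner x y = 0")
  case False
  define c where "c = cnj (cinner x y) / of_real (cmod (cinner x y))"
  have c: "cmod c = 1" using False by (simp add: c_def norm_divide)
  have "cinner x (cscale c y) = (cinner x y * cnj (cinner x y)) / of_real (cmod (cinner x y))"
    unfolding cinner_cscale_right c_def times_divide_eq_left by (rule arg_cong2[where f="(/)"]) (rule mult.commute, rule refl)
  also have "\<dots> = of_real ((cmod (cinner x y))\<^sup>2) / of_real (cmod (cinner x y))"
    by (simp only: complex_norm_square)
  also have "\<dots> = of_real (cmod (cinner x y))"
    using False unfolding of_real_divide[symmetric] by (simp add: power2_eq_square)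
  finally have "cmod (cinner x y) = x \<bullet> cscale c y"
    by (metis Re_cinner Re_complex_of_real)
  also have "\<dots> \<le> norm x * norm (cscale c y)" by (rule norm_cauchy_schwarz)
  finally show ?thesis by (simp add: norm_cscale c)
qed simp


section \<open>Bounded operators on the sequence space and their adjoints\<close>

text \<open>The type \<^typ>\<open>l2 \<Rightarrow>\<^sub>L l2\<close> consists of the bounded real-linear operators; complex linearity
  is imposed separately. Its norm is the operator norm.\<close>

definition clinear_op :: "(l2 \<Rightarrow>\<^sub>L l2) \<Rightarrow> bool" where
  "clinear_op T \<longleftrightarrow> (\<forall>c x. T (cscale c x) = cscale c (T x))"

lift_definition scalar_op :: "complex \<Rightarrow> (l2 \<Rightarrow>\<^sub>L l2)" is cscale
proof (rule bounded_linear_intro)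
  fix c :: complex
  show "cscale c (x + y) = cscale c x + cscale c y" for x y
    by transfer (simp add: distrib_left)
  show "cscale c (r *\<^sub>R x) = r *\<^sub>R cscale c x" for r x
    by transfer (simp add: scaleR_conv_of_real mult.left_commute)
  show "norm (cscale c x) \<le> norm x * cmod c" for x
    by (simp add: norm_cscale mult.commute)
qed

definition adj :: "(l2 \<Rightarrow>\<^sub>L l2) \<Rightarrow> (l2 \<Rightarrow>\<^sub>L l2)" where
  "adj T = (THE S :: l2 \<Rightarrow>\<^sub>L l2. \<forall>x y. cinner (S x) y = cinner x (T y))"

lift_definition trunc :: "nat \<Rightarrow> (nat \<Rightarrow> complex) \<Rightarrow> l2" is "\<lambda>N f n. if n < N then f n else 0"
  subgoal for N f by (rule summable_finite[of "{..<N}"]) auto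
  done

lemma trunc_Suc: "trunc (Suc N) f = trunc N f + cscale (f N) (trunc (Suc N) (\<lambda>n. if n = N then 1 else 0))"
  unfolding coord_inject[symmetric] fun_eq_iff plus_l2.rep_eq cscale.rep_eq trunc.rep_eq
  by (simp add: less_Suc_eq)

lemma trunc_0: "trunc 0 f = 0"
  unfolding coord_inject[symmetric] fun_eq_iff zero_l2.rep_eq trunc.rep_eq by simp

lemma cinner_trunc: "cinner (trunc N f) y = (\<Sum>n<N. cnj (f n) * coord y n)"
  unfolding cinner_def trunc.rep_eq
  by (subst suminf_finite[of "{..<N}"]) simp_all

lemma norm_trunc: "(norm (trunc N f))\<^sup>2 = (\<Sum>n<N. (cmod (f n))\<^sup>2)"
proof -
  have "complex_of_real ((norm (trunc N f))\<^sup>2) = (\<Sum>n<N. cnj (f n) * f n)"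
    unfolding cinner_self[symmetric] cinner_trunc by (rule sum.cong) (simp_all add: trunc.rep_eq)
  also have "\<dots> = of_real (\<Sum>n<N. (cmod (f n))\<^sup>2)"
    unfolding of_real_sum
    by (rule sum.cong) (simp_all only: complex_norm_square mult.commute[of "cnj _"])
  finally show ?thesis unfolding of_real_eq_iff .
qed

lemma norm_l2_sums: "(\<lambda>n. (cmod (coord y n))\<^sup>2) sums (norm y)\<^sup>2"
proof -
  have "(norm y)\<^sup>2 = (\<Sum>n. (cmod (coord y n))\<^sup>2)"
    unfolding dot_square_norm[symmetric] inner_l2_def ..
  moreover have "summable (\<lambda>n. (cmod (coord y n))\<^sup>2)" using coord[of y] by simp
  ultimately show ?thesis by (simp only: summable_sums)
qed

lemma trunc_tendsto: "(\<lambda>N. trunc N (coord y)) \<longlonglongrightarrow> y"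
proof -
  have eq: "(norm (trunc N (coord y) - y))\<^sup>2 = (norm y)\<^sup>2 - (\<Sum>n<N. (cmod (coord y n))\<^sup>2)" for N
  proof -
    let ?t = "trunc N (coord y)"
    have "cinner ?t y = cinner ?t ?t"
      unfolding cinner_trunc by (rule sum.cong) (auto simp: trunc.rep_eq)
    then have "?t \<bullet> y = ?t \<bullet> ?t" unfolding Re_cinner[symmetric] by (rule arg_cong)
    moreover have "y \<bullet> ?t = ?t \<bullet> y" by (rule inner_commute)
    ultimately have "(norm (?t - y))\<^sup>2 = (norm y)\<^sup>2 - (norm ?t)\<^sup>2"
      unfolding power2_norm_eq_inner inner_diff_left inner_diff_right by linarith
    then show ?thesis by (simp add: norm_trunc)
  qed
  have "(\<lambda>N. (norm y)\<^sup>2 - (\<Sum>n<N. (cmod (coord y n))\<^sup>2)) \<longlonglongrightarrow> (norm y)\<^sup>2 - (norm y)\<^sup>2"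
    using norm_l2_sums[of y] unfolding sums_def by (intro tendsto_diff tendsto_const)
  then have "(\<lambda>N. sqrt ((norm (trunc N (coord y) - y))\<^sup>2)) \<longlonglongrightarrow> sqrt 0"
    unfolding eq by (intro tendsto_real_sqrt) simp
  then have "(\<lambda>N. norm (trunc N (coord y) - y)) \<longlonglongrightarrow> 0" by simp
  then show ?thesis by (rule LIM_zero_cancel[OF tendsto_norm_zero_cancel])
qed

lemma riesz_l2:
  assumes add: "\<And>x y. \<phi> (x + y) = \<phi> x + \<phi> y"
    and scale: "\<And>c x. \<phi> (cscale c x) = c * \<phi> x"
    and bound: "\<And>x. cmod (\<phi> x) \<le> B * norm x"
  shows "\<exists>z. \<forall>y. \<phi> y = cinner z y"
proof -
  define b where "b N = \<phi> (trunc (Suc N) (\<lambda>n. if n = N then 1 else 0))" for N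
  have \<phi>0: "\<phi> 0 = 0" using add[of 0 0] by simp
  have tr: "\<phi> (trunc N f) = (\<Sum>n<N. f n * b n)" for N f
  proof (induction N)
    case 0 then show ?case by (simp add: trunc_0 \<phi>0)
  next
    case (Suc N)
    show ?case
      unfolding trunc_Suc[of N f] add scale Suc.IH by (simp add: b_def)
  qed
  have le: "(\<Sum>n<N. (cmod (b n))\<^sup>2) \<le> B\<^sup>2" for N
  proof -
    let ?w = "trunc N (\<lambda>n. cnj (b n))"
    have "\<phi> ?w = of_real (\<Sum>n<N. (cmod (b n))\<^sup>2)"
      unfolding tr of_real_sum
      by (rule sum.cong) (simp_all only: complex_norm_square mult.commute[of "cnj _"])
    then have "cmod (\<phi> ?w) = \<bar>\<Sum>n<N. (cmod (b n))\<^sup>2\<bar>"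
      by (simp only: norm_of_real)
    then have "cmod (\<phi> ?w) = (norm ?w)\<^sup>2"
      unfolding norm_trunc by (simp add: sum_nonneg)
    then have "norm ?w * norm ?w \<le> B * norm ?w"
      using bound[of ?w] by (simp add: power2_eq_square)
    then have "norm ?w \<le> \<bar>B\<bar>"
      by (cases "norm ?w = 0") (auto dest: mult_right_le_imp_le)
    then have "(norm ?w)\<^sup>2 \<le> B\<^sup>2" using abs_le_square_iff[of "norm ?w" B] by simp
    then show ?thesis by (simp add: norm_trunc)
  qed
  have sm: "summable (\<lambda>n. (cmod (cnj (b n)))\<^sup>2)"
    by (rule bounded_imp_summable[of _ "B\<^sup>2"])
       (simp_all only: lessThan_Suc_atMost[symmetric] complex_mod_cnj le zero_le_power2)
  define z where "z = Abs_l2 (\<lambda>n. cnj (b n))"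
  have z: "coord z = (\<lambda>n. cnj (b n))"
    unfolding z_def using sm by (simp add: Abs_l2_inverse)
  have "\<phi> y = cinner z y" for y
  proof -
    have "(\<lambda>N. \<phi> (trunc N (coord y)) - \<phi> y) \<longlonglongrightarrow> 0"
    proof (rule Lim_null_comparison)
      have "\<phi> (u - v) = \<phi> u - \<phi> v" for u v using add[of "u - v" v] by simp
      then show "\<forall>\<^sub>F N in sequentially. norm (\<phi> (trunc N (coord y)) - \<phi> y) \<le> B * norm (trunc N (coord y) - y)"
        by (intro always_eventually allI) (metis bound)
      show "(\<lambda>N. B * norm (trunc N (coord y) - y)) \<longlonglongrightarrow> 0"
        by (intro tendsto_mult_right_zero tendsto_norm_zero LIM_zero trunc_tendsto)
    qed
    then have "(\<lambda>N. \<phi> (trunc N (coord y))) \<longlonglongrightarrow> \<phi> y" by (simp add: LIM_zero_iff)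
    then have "(\<lambda>N. \<Sum>n<N. cnj (coord z n) * coord y n) \<longlonglongrightarrow> \<phi> y"
      unfolding tr z by (simp add: mult.commute)
    moreover have "(\<lambda>N. \<Sum>n<N. cnj (coord z n) * coord y n) \<longlonglongrightarrow> cinner z y"
      using summable_sums[OF summable_cinner[of z y]] by (simp add: cinner_def sums_def)
    ultimately show ?thesis by (rule LIMSEQ_unique)
  qed
  then show ?thesis by blast
qed

lemma cinner_adj:
  assumes T: "clinear_op T"
  shows "cinner (adj T x) y = cinner x (T y)"
proof -
  have "\<exists>z. \<forall>y. cinner x (T y) = cinner z y" for x
  proof (rule riesz_l2)
    show "cinner x (T (y + z)) = cinner x (T y) + cinner x (T z)" for y z
      by (simp add: blinfun.add_right cinner_add_right)
    show "cinner x (T (cscale c y)) = c * cinner x (T y)" for c y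
      using T by (simp add: clinear_op_def cinner_cscale_right)
    show "cmod (cinner x (T y)) \<le> (norm x * norm T) * norm y" for y
    proof -
      have "cmod (cinner x (T y)) \<le> norm x * norm (T y)" by (rule cinner_Cauchy_Schwarz)
      also have "\<dots> \<le> norm x * (norm T * norm y)"
        by (intro mult_left_mono norm_blinfun) auto
      finally show ?thesis by (simp add: mult.assoc)
    qed
  qed
  then obtain s where s: "\<And>x y. cinner x (T y) = cinner (s x) y" by metis
  have eqI: "u = v" if "\<And>y. cinner u y = cinner v y" for u v
  proof (rule cinner_eqI)
    show "cinner y u = cinner y v" for y
      using that[of y] cinner_commute[of y u] cinner_commute[of y v] by simp
  qed
  have "bounded_linear s"
  proof (rule bounded_linear_intro)
    show "s (x + y) = s x + s y" for x y
      by (rule eqI) (simp add: s[symmetric] cinner_add_left)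
    show "s (r *\<^sub>R x) = r *\<^sub>R s x" for r x
      by (rule eqI) (simp add: s[symmetric] cscale_of_real[symmetric] cinner_cscale_left)
    show "norm (s x) \<le> norm x * norm T" for x
    proof -
      have "(norm (s x))\<^sup>2 = cmod (cinner (s x) (s x))"
        by (simp add: cinner_self norm_power)
      also have "\<dots> = cmod (cinner x (T (s x)))" by (simp add: s)
      also have "\<dots> \<le> norm x * norm (T (s x))" by (rule cinner_Cauchy_Schwarz)
      also have "\<dots> \<le> norm x * (norm T * norm (s x))"
        by (intro mult_left_mono norm_blinfun) auto
      finally show ?thesis
        by (cases "norm (s x) = 0") (auto simp: power2_eq_square mult.assoc[symmetric])
    qed
  qed
  then have S: "\<forall>x y. cinner (Blinfun s x) y = cinner x (T y)"
    by (simp add: bounded_linear_Blinfun_apply s)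
  have "adj T = Blinfun s"
    unfolding adj_def
  proof (rule the_equality)
    show "\<forall>x y. cinner (Blinfun s x) y = cinner x (T y)" by (rule S)
    fix S' :: "l2 \<Rightarrow>\<^sub>L l2"
    assume "\<forall>x y. cinner (S' x) y = cinner x (T y)"
    then show "S' = Blinfun s" using S by (intro blinfun_eqI eqI) simp
  qed
  then show ?thesis using S by simp
qed

definition positive_op :: "(l2 \<Rightarrow>\<^sub>L l2) \<Rightarrow> bool" where
  "positive_op T \<longleftrightarrow> clinear_op T \<and> (\<forall>x. cinner x (T x) \<in> \<real>\<^sub>\<ge>\<^sub>0)"

definition compact_op :: "(l2 \<Rightarrow>\<^sub>L l2) \<Rightarrow> bool" where
  "compact_op T \<longleftrightarrow> clinear_op T \<and> compact (closure (T ` cball 0 1))"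

definition compact_plus_scalars :: "(l2 \<Rightarrow>\<^sub>L l2) set" where
  "compact_plus_scalars = {K + scalar_op c | K c. compact_op K}"


section \<open>The enveloping von Neumann algebra\<close>

text \<open>Below, \<open>A\<close> is a C*-algebra of operators on \<^typ>\<open>l2\<close>. Its dual \<open>A*\<close> and bidual \<open>A**\<close> are
  carrier sets of functions; to make a functional determined by its values, it is required to
  vanish off its domain.\<close>

definition cutoff :: "'a set \<Rightarrow> ('a \<Rightarrow> complex) \<Rightarrow> 'a \<Rightarrow> complex" where
  "cutoff S f = (\<lambda>x. if x \<in> S then f x else 0)"

type_synonym op_functional = "(l2 \<Rightarrow>\<^sub>L l2) \<Rightarrow> complex"

definition dual :: "(l2 \<Rightarrow>\<^sub>L l2) set \<Rightarrow> op_functional set" where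
  "dual A = {\<phi>.
     (\<forall>a\<in>A. \<forall>b\<in>A. \<phi> (a + b) = \<phi> a + \<phi> b) \<and>
     (\<forall>c. \<forall>a\<in>A. \<phi> (scalar_op c o\<^sub>L a) = c * \<phi> a) \<and>
     (\<exists>B. \<forall>a\<in>A. cmod (\<phi> a) \<le> B * norm a) \<and>
     (\<forall>a. a \<notin> A \<longrightarrow> \<phi> a = 0)}"

definition dual_norm :: "(l2 \<Rightarrow>\<^sub>L l2) set \<Rightarrow> op_functional \<Rightarrow> real" where
  "dual_norm A \<phi> = (SUP a\<in>{a \<in> A. norm a \<le> 1}. cmod (\<phi> a))"

definition bidual :: "(l2 \<Rightarrow>\<^sub>L l2) set \<Rightarrow> (op_functional \<Rightarrow> complex) set" where
  "bidual A = {S.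
     (\<forall>\<phi>\<in>dual A. \<forall>\<psi>\<in>dual A. S (\<lambda>a. \<phi> a + \<psi> a) = S \<phi> + S \<psi>) \<and>
     (\<forall>c. \<forall>\<phi>\<in>dual A. S (\<lambda>a. c * \<phi> a) = c * S \<phi>) \<and>
     (\<exists>B. \<forall>\<phi>\<in>dual A. cmod (S \<phi>) \<le> B * dual_norm A \<phi>) \<and>
     (\<forall>\<phi>. \<phi> \<notin> dual A \<longrightarrow> S \<phi> = 0)}"

definition bidual_embed :: "(l2 \<Rightarrow>\<^sub>L l2) set \<Rightarrow> (l2 \<Rightarrow>\<^sub>L l2) \<Rightarrow> op_functional \<Rightarrow> complex" where
  "bidual_embed A a = cutoff (dual A) (\<lambda>\<phi>. \<phi> a)"

text \<open>The enveloping von Neumann algebra of \<open>A\<close> is the bidual with the Arens product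
  \<open>(S T)(\<phi>) = S (a \<mapsto> T (b \<mapsto> \<phi> (a b)))\<close> and the involution \<open>S\<^sup>*(\<phi>) = cnj (S (\<phi>\<^sup>*))\<close>, where
  \<open>\<phi>\<^sup>*(a) = cnj (\<phi> (a\<^sup>*))\<close>; both extend the operations of \<open>A\<close>. Its predual is \<open>A*\<close>.\<close>

definition bidual_mult :: "(l2 \<Rightarrow>\<^sub>L l2) set \<Rightarrow> (op_functional \<Rightarrow> complex) \<Rightarrow>
    (op_functional \<Rightarrow> complex) \<Rightarrow> op_functional \<Rightarrow> complex" where
  "bidual_mult A S T =
     cutoff (dual A) (\<lambda>\<phi>. S (cutoff A (\<lambda>a. T (cutoff A (\<lambda>b. \<phi> (a o\<^sub>L b))))))"

definition bidual_star :: "(l2 \<Rightarrow>\<^sub>L l2) set \<Rightarrow> (op_functional \<Rightarrow> complex) \<Rightarrow>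
    op_functional \<Rightarrow> complex" where
  "bidual_star A S = cutoff (dual A) (\<lambda>\<phi>. cnj (S (cutoff A (\<lambda>a. cnj (\<phi> (adj a))))))"

definition bidual_le :: "(l2 \<Rightarrow>\<^sub>L l2) set \<Rightarrow> (op_functional \<Rightarrow> complex) \<Rightarrow>
    (op_functional \<Rightarrow> complex) \<Rightarrow> bool" where
  "bidual_le A S T \<longleftrightarrow>
     (\<exists>R\<in>bidual A. (\<lambda>\<phi>. T \<phi> - S \<phi>) = bidual_mult A (bidual_star A R) R)"

text \<open>The ultraweak topology of a von Neumann algebra is its weak* topology as the dual of its
  predual, here the topology of pointwise convergence on \<open>A*\<close>. An unordered sum is the limit of
  the net of its finite partial sums.\<close>

definition ultraweak_has_sum :: "(l2 \<Rightarrow>\<^sub>L l2) set \<Rightarrow> ('j \<Rightarrow> op_functional \<Rightarrow> complex) \<Rightarrow>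
    (op_functional \<Rightarrow> complex) \<Rightarrow> 'j set \<Rightarrow> bool" where
  "ultraweak_has_sum A s S J \<longleftrightarrow>
     S \<in> bidual A \<and> (\<forall>\<phi>\<in>dual A. ((\<lambda>j. s j \<phi>) has_sum S \<phi>) J)"


section \<open>Hilbert modules and frames\<close>

record 'x hilbert_structure =
  hcarrier :: "'x set"
  hadd :: "'x \<Rightarrow> 'x \<Rightarrow> 'x"
  hzero :: 'x
  hscale :: "complex \<Rightarrow> 'x \<Rightarrow> 'x"
  hact :: "'x \<Rightarrow> (l2 \<Rightarrow>\<^sub>L l2) \<Rightarrow> 'x"
  hinner :: "'x \<Rightarrow> 'x \<Rightarrow> (l2 \<Rightarrow>\<^sub>L l2)"

definition hnorm :: "'x hilbert_structure \<Rightarrow> 'x \<Rightarrow> real" where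
  "hnorm X x = sqrt (norm (hinner X x x))"

definition hdist :: "'x hilbert_structure \<Rightarrow> 'x \<Rightarrow> 'x \<Rightarrow> real" where
  "hdist X x y = hnorm X (hadd X x (hscale X (-1) y))"

locale hilbert_module =
  fixes A :: "(l2 \<Rightarrow>\<^sub>L l2) set" and X :: "'x hilbert_structure"
  assumes add_closed: "\<lbrakk>x \<in> hcarrier X; y \<in> hcarrier X\<rbrakk> \<Longrightarrow> hadd X x y \<in> hcarrier X"
    and zero_closed: "hzero X \<in> hcarrier X"
    and scale_closed: "x \<in> hcarrier X \<Longrightarrow> hscale X c x \<in> hcarrier X"
    and act_closed: "\<lbrakk>x \<in> hcarrier X; a \<in> A\<rbrakk> \<Longrightarrow> hact X x a \<in> hcarrier X"
    and inner_closed: "\<lbrakk>x \<in> hcarrier X; y \<in> hcarrier X\<rbrakk> \<Longrightarrow> hinner X x y \<in> A"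
    and add_assoc: "\<lbrakk>x \<in> hcarrier X; y \<in> hcarrier X; z \<in> hcarrier X\<rbrakk> \<Longrightarrow>
      hadd X (hadd X x y) z = hadd X x (hadd X y z)"
    and add_commute: "\<lbrakk>x \<in> hcarrier X; y \<in> hcarrier X\<rbrakk> \<Longrightarrow> hadd X x y = hadd X y x"
    and add_zero: "x \<in> hcarrier X \<Longrightarrow> hadd X (hzero X) x = x"
    and add_minus: "x \<in> hcarrier X \<Longrightarrow> hadd X x (hscale X (-1) x) = hzero X"
    and scale_add_right: "\<lbrakk>x \<in> hcarrier X; y \<in> hcarrier X\<rbrakk> \<Longrightarrow>
      hscale X c (hadd X x y) = hadd X (hscale X c x) (hscale X c y)"
    and scale_add_left: "x \<in> hcarrier X \<Longrightarrow>
      hscale X (c + d) x = hadd X (hscale X c x) (hscale X d x)"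
    and scale_scale: "x \<in> hcarrier X \<Longrightarrow> hscale X c (hscale X d x) = hscale X (c * d) x"
    and scale_one: "x \<in> hcarrier X \<Longrightarrow> hscale X 1 x = x"
    and act_add_right: "\<lbrakk>x \<in> hcarrier X; a \<in> A; b \<in> A\<rbrakk> \<Longrightarrow>
      hact X x (a + b) = hadd X (hact X x a) (hact X x b)"
    and act_add_left: "\<lbrakk>x \<in> hcarrier X; y \<in> hcarrier X; a \<in> A\<rbrakk> \<Longrightarrow>
      hact X (hadd X x y) a = hadd X (hact X x a) (hact X y a)"
    and act_act: "\<lbrakk>x \<in> hcarrier X; a \<in> A; b \<in> A\<rbrakk> \<Longrightarrow>
      hact X (hact X x a) b = hact X x (a o\<^sub>L b)"
    and act_scale_left: "\<lbrakk>x \<in> hcarrier X; a \<in> A\<rbrakk> \<Longrightarrow>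
      hact X (hscale X c x) a = hscale X c (hact X x a)"
    and act_scale_right: "\<lbrakk>x \<in> hcarrier X; a \<in> A\<rbrakk> \<Longrightarrow>
      hact X x (scalar_op c o\<^sub>L a) = hscale X c (hact X x a)"
    and inner_add_right: "\<lbrakk>x \<in> hcarrier X; y \<in> hcarrier X; z \<in> hcarrier X\<rbrakk> \<Longrightarrow>
      hinner X x (hadd X y z) = hinner X x y + hinner X x z"
    and inner_scale_right: "\<lbrakk>x \<in> hcarrier X; y \<in> hcarrier X\<rbrakk> \<Longrightarrow>
      hinner X x (hscale X c y) = scalar_op c o\<^sub>L hinner X x y"
    and inner_act_right: "\<lbrakk>x \<in> hcarrier X; y \<in> hcarrier X; a \<in> A\<rbrakk> \<Longrightarrow>
      hinner X x (hact X y a) = hinner X x y o\<^sub>L a"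
    and inner_commute: "\<lbrakk>x \<in> hcarrier X; y \<in> hcarrier X\<rbrakk> \<Longrightarrow>
      hinner X y x = adj (hinner X x y)"
    and inner_positive: "x \<in> hcarrier X \<Longrightarrow> positive_op (hinner X x x)"
    and inner_definite: "\<lbrakk>x \<in> hcarrier X; hinner X x x = 0\<rbrakk> \<Longrightarrow> x = hzero X"
    and complete: "\<lbrakk>\<And>n. u n \<in> hcarrier X;
        \<And>e. e > 0 \<Longrightarrow> \<exists>N::nat. \<forall>m\<ge>N. \<forall>n\<ge>N. hdist X (u m) (u n) < e\<rbrakk> \<Longrightarrow>
      \<exists>x\<in>hcarrier X. (\<lambda>n. hdist X (u n) x) \<longlonglongrightarrow> 0"

definition is_frame :: "(l2 \<Rightarrow>\<^sub>L l2) set \<Rightarrow> 'x hilbert_structure \<Rightarrow> 'j set \<Rightarrow> ('j \<Rightarrow> 'x) \<Rightarrow> bool"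
  where
  "is_frame A X J x \<longleftrightarrow> (\<forall>j\<in>J. x j \<in> hcarrier X) \<and>
     (\<exists>C>0. \<exists>D>0. \<forall>y\<in>hcarrier X. \<exists>S.
        ultraweak_has_sum A (\<lambda>j. bidual_embed A (hinner X y (x j) o\<^sub>L hinner X (x j) y)) S J \<and>
        bidual_le A (\<lambda>\<phi>. complex_of_real C * bidual_embed A (hinner X y y) \<phi>) S \<and>
        bidual_le A S (\<lambda>\<phi>. complex_of_real D * bidual_embed A (hinner X y y) \<phi>))"

text \<open>Index sets of frames are arbitrary, but HOL cannot quantify over types. The index type
  \<^typ>\<open>'x \<times> nat\<close> loses nothing: zero members of a frame may be dropped, and a nonzero element
  occurs only finitely often. This is the content of \<open>possesses_frameI\<close> below, where the index type
  is arbitrary.\<close>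

definition possesses_frame :: "(l2 \<Rightarrow>\<^sub>L l2) set \<Rightarrow> 'x hilbert_structure \<Rightarrow> bool" where
  "possesses_frame A X \<longleftrightarrow> (\<exists>(J :: ('x \<times> nat) set) x. is_frame A X J x)"

lemma compact_opI:
  assumes "clinear_op T" "compact C" "T ` cball 0 1 \<subseteq> C"
  shows "compact_op T"
proof -
  have "closure (T ` cball 0 1) \<subseteq> C"
    using assms by (intro closure_minimal compact_imp_closed)
  then have "compact (closure (T ` cball 0 1))"
    using compact_Int_closed[OF assms(2) closed_closure[of "T ` cball 0 1"]]
    by (simp add: Int_absorb1)
  then show ?thesis using assms(1) by (simp add: compact_op_def)
qed

lemma clinear_scalar_op: "clinear_op (scalar_op c)"
  unfolding clinear_op_def scalar_op.rep_eq
  by (transfer, simp add: mult.left_commute)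

lemma clinear_op_add: "clinear_op S \<Longrightarrow> clinear_op T \<Longrightarrow> clinear_op (S + T)"
  by (simp add: clinear_op_def plus_blinfun.rep_eq scalar_op.rep_eq[symmetric] blinfun.add_right)

lemma clinear_op_comp: "clinear_op S \<Longrightarrow> clinear_op T \<Longrightarrow> clinear_op (S o\<^sub>L T)"
  by (simp add: clinear_op_def)

lemma compact_op_add:
  assumes "compact_op S" "compact_op T"
  shows "compact_op (S + T)"
proof (rule compact_opI)
  show "clinear_op (S + T)"
    using assms by (auto simp: compact_op_def intro: clinear_op_add)
  show "compact {x + y | x y. x \<in> closure (S ` cball 0 1) \<and> y \<in> closure (T ` cball 0 1)}"
    using assms by (intro compact_sums) (auto simp: compact_op_def)
  show "(S + T) ` cball 0 1 \<subseteq>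
      {x + y | x y. x \<in> closure (S ` cball 0 1) \<and> y \<in> closure (T ` cball 0 1)}"
  proof (rule image_subsetI)
    fix x :: l2 assume "x \<in> cball 0 1"
    then have "S x \<in> closure (S ` cball 0 1)" "T x \<in> closure (T ` cball 0 1)"
      by (intro subsetD[OF closure_subset] imageI; simp)+
    then show "(S + T) x \<in>
        {x + y | x y. x \<in> closure (S ` cball 0 1) \<and> y \<in> closure (T ` cball 0 1)}"
      by (intro CollectI exI[of _ "S x"] exI[of _ "T x"] conjI) (simp_all add: plus_blinfun.rep_eq)
  qed
qed

lemma compact_op_comp_left:
  assumes "clinear_op S" "compact_op T"
  shows "compact_op (S o\<^sub>L T)"
proof (rule compact_opI)
  show "clinear_op (S o\<^sub>L T)"
    using assms by (auto simp: compact_op_def intro: clinear_op_comp)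
  show "compact (S ` closure (T ` cball 0 1))"
    using assms by (intro compact_continuous_image linear_continuous_on
      blinfun.bounded_linear_right) (auto simp: compact_op_def)
  show "(S o\<^sub>L T) ` cball 0 1 \<subseteq> S ` closure (T ` cball 0 1)"
    by (intro image_subsetI) (auto intro!: imageI subsetD[OF closure_subset])
qed

lemma compact_op_comp_right:
  assumes "compact_op S" "clinear_op T"
  shows "compact_op (S o\<^sub>L T)"
proof (rule compact_opI)
  show "clinear_op (S o\<^sub>L T)"
    using assms by (auto simp: compact_op_def intro: clinear_op_comp)
  show "compact ((\<lambda>x. (norm T + 1) *\<^sub>R x) ` closure (S ` cball 0 1))"
    using assms by (intro compact_scaling) (auto simp: compact_op_def)
  show "(S o\<^sub>L T) ` cball 0 1 \<subseteq> (\<lambda>x. (norm T + 1) *\<^sub>R x) ` closure (S ` cball 0 1)"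
  proof (rule image_subsetI)
    fix x :: l2 assume "x \<in> cball 0 1"
    then have x: "norm x \<le> 1" by simp
    define r where "r = norm T + 1"
    have r: "r > 0" using norm_ge_zero[of T] by (simp add: r_def add_nonneg_pos)
    have "norm (T x) \<le> norm T * norm x" by (rule norm_blinfun)
    also have "\<dots> \<le> norm T * 1" using x by (intro mult_left_mono) auto
    finally have "norm (T x) \<le> r" by (simp add: r_def)
    then have "(1 / r) *\<^sub>R T x \<in> cball 0 1" using r by (simp add: divide_simps)
    then have mem: "S ((1 / r) *\<^sub>R T x) \<in> closure (S ` cball 0 1)"
      by (intro subsetD[OF closure_subset] imageI)
    have "(S o\<^sub>L T) x = r *\<^sub>R S ((1 / r) *\<^sub>R T x)"
      using r by (simp add: blinfun.scaleR_right)
    then show "(S o\<^sub>L T) x \<in> (\<lambda>x. (norm T + 1) *\<^sub>R x) ` closure (S ` cball 0 1)"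
      using mem unfolding r_def by (rule image_eqI)
  qed
qed

lemma cps_clinear: "a \<in> compact_plus_scalars \<Longrightarrow> clinear_op a"
  by (auto simp: compact_plus_scalars_def compact_op_def intro: clinear_op_add clinear_scalar_op)

lemma scalar_op_add: "scalar_op (c + d) = scalar_op c + scalar_op d"
  by (rule blinfun_eqI) (simp add: scalar_op.rep_eq plus_blinfun.rep_eq, transfer, simp add: distrib_right)

lemma scalar_op_mult: "scalar_op c o\<^sub>L scalar_op d = scalar_op (c * d)"
  by (rule blinfun_eqI) (simp add: scalar_op.rep_eq, transfer, simp add: mult.assoc)

lemma cps_add:
  assumes "a \<in> compact_plus_scalars" "b \<in> compact_plus_scalars"
  shows "a + b \<in> compact_plus_scalars"
proof -
  obtain K c L d where "a = K + scalar_op c" "b = L + scalar_op d" "compact_op K" "compact_op L"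
    using assms by (auto simp: compact_plus_scalars_def)
  then have "a + b = (K + L) + scalar_op (c + d)" "compact_op (K + L)"
    by (auto simp: scalar_op_add compact_op_add)
  then show ?thesis unfolding compact_plus_scalars_def by blast
qed

lemma cps_comp:
  assumes "a \<in> compact_plus_scalars" "b \<in> compact_plus_scalars"
  shows "a o\<^sub>L b \<in> compact_plus_scalars"
proof -
  obtain K c L d where eq: "a = K + scalar_op c" "b = L + scalar_op d"
    and K: "compact_op K" and L: "compact_op L"
    using assms by (auto simp: compact_plus_scalars_def)
  have "a o\<^sub>L b = ((K o\<^sub>L b) + (scalar_op c o\<^sub>L L)) + scalar_op (c * d)"
    unfolding scalar_op_mult[symmetric] eq
    by (rule blinfun_eqI) (simp add: plus_blinfun.rep_eq blinfun.add_right)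
  moreover have "compact_op ((K o\<^sub>L b) + (scalar_op c o\<^sub>L L))"
    using K L cps_clinear[OF assms(2)]
    by (intro compact_op_add compact_op_comp_left compact_op_comp_right clinear_scalar_op)
  ultimately show ?thesis unfolding compact_plus_scalars_def by blast
qed

lemma scalar_in_cps: "scalar_op c \<in> compact_plus_scalars"
proof -
  have "compact_op 0"
    by (rule compact_opI[of _ "{0}"]) (auto simp: clinear_op_def, transfer, simp)
  then show ?thesis unfolding compact_plus_scalars_def by force
qed

lemma vector_functional_in_dual:
  "cutoff compact_plus_scalars (\<lambda>a. cinner x (a y)) \<in> dual compact_plus_scalars"
proof -
  have "cmod (cinner x (a y)) \<le> (norm x * norm y) * norm a" for a :: "l2 \<Rightarrow>\<^sub>L l2"
  proof -
    have "cmod (cinner x (a y)) \<le> norm x * norm (a y)" by (rule cinner_Cauchy_Schwarz)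
    also have "\<dots> \<le> norm x * (norm a * norm y)"
      by (intro mult_left_mono norm_blinfun) auto
    finally show ?thesis by (simp add: mult_ac)
  qed
  then show ?thesis
    unfolding dual_def cutoff_def
    by (auto simp: cps_add cps_comp scalar_in_cps plus_blinfun.rep_eq cinner_add_right
        scalar_op.rep_eq cinner_cscale_right)
qed

lemma possesses_frameI:
  fixes X :: "'x hilbert_structure" and J :: "'j set"
  assumes X: "hilbert_module compact_plus_scalars X"
    and frame: "is_frame compact_plus_scalars X J x"
  shows "possesses_frame compact_plus_scalars X"
proof -
  interpret hilbert_module compact_plus_scalars X by (rule X)
  let ?A = compact_plus_scalars
  obtain C D where C: "C > 0" and D: "D > 0" and CD: "\<And>y. y \<in> hcarrier X \<Longrightarrow> \<exists>S.
      ultraweak_has_sum ?A (\<lambda>j. bidual_embed ?A (hinner X y (x j) o\<^sub>L hinner X (x j) y)) S J \<and>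
      bidual_le ?A (\<lambda>\<phi>. complex_of_real C * bidual_embed ?A (hinner X y y) \<phi>) S \<and>
      bidual_le ?A S (\<lambda>\<phi>. complex_of_real D * bidual_embed ?A (hinner X y y) \<phi>)"
    using frame unfolding is_frame_def by (elim conjE exE) (rule that, assumption, assumption, erule (1) bspec)
  have xc: "\<And>j. j \<in> J \<Longrightarrow> x j \<in> hcarrier X" using frame by (simp add: is_frame_def)
  define J0 where "J0 = {j \<in> J. x j \<noteq> hzero X}"
  have fin: "finite {j \<in> J. x j = y}" if y: "y \<in> hcarrier X" "y \<noteq> hzero X" for y
  proof (rule ccontr)
    let ?F = "{j \<in> J. x j = y}"
    assume inf: "infinite ?F"
    define a where "a = hinner X y y"
    have aA: "a \<in> ?A" using y by (simp add: a_def inner_closed)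
    have "a \<noteq> 0" using y inner_definite by (auto simp: a_def)
    then obtain v where v: "a v \<noteq> 0" by (metis blinfun_eqI zero_blinfun.rep_eq)
    have sa: "cinner (a u) w = cinner u (a w)" for u w
      using cinner_adj[OF cps_clinear[OF aA]] inner_commute[OF y(1) y(1)] by (simp add: a_def)
    define \<phi> where "\<phi> = cutoff ?A (\<lambda>b. cinner v (b v))"
    have \<phi>: "\<phi> \<in> dual ?A" unfolding \<phi>_def by (rule vector_functional_in_dual)
    have val: "\<phi> (a o\<^sub>L a) = of_real ((norm (a v))\<^sup>2)"
      using cps_comp[OF aA aA] by (simp add: \<phi>_def cutoff_def sa[symmetric] cinner_self)
    obtain S where "ultraweak_has_sum ?A
        (\<lambda>j. bidual_embed ?A (hinner X y (x j) o\<^sub>L hinner X (x j) y)) S J"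
      using CD[OF y(1)] by (elim exE conjE)
    then have "((\<lambda>j. \<phi> (hinner X y (x j) o\<^sub>L hinner X (x j) y)) has_sum S \<phi>) J"
      using \<phi> by (simp add: ultraweak_has_sum_def bidual_embed_def cutoff_def)
    then have "(\<lambda>j. \<phi> (hinner X y (x j) o\<^sub>L hinner X (x j) y)) summable_on ?F"
      by (rule summable_on_subset_banach[OF has_sum_imp_summable]) simp
    then have "(\<lambda>j. complex_of_real ((norm (a v))\<^sup>2)) summable_on ?F"
      by (rule summable_on_cong[THEN iffD1, rotated]) (use val in \<open>simp add: a_def\<close>)
    then have "(\<lambda>j. (norm (a v))\<^sup>2) summable_on ?F"
      by (drule_tac summable_on_Re) (simp only: Re_complex_of_real)
    then have "(norm (a v))\<^sup>2 = 0"
      using inf infsum_diverge_constant[of ?F "(norm (a v))\<^sup>2"] by argo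
    then show False using v by simp
  qed
  define h where "h y = (SOME f :: 'j \<Rightarrow> nat. inj_on f {j \<in> J. x j = y})" for y
  have h: "inj_on (h (x i)) {j \<in> J. x j = x i}" if "i \<in> J0" for i
  proof -
    have "finite {j \<in> J. x j = x i}"
      using that xc by (intro fin) (simp_all add: J0_def)
    then obtain f :: "'j \<Rightarrow> nat" where "inj_on f {j \<in> J. x j = x i}"
      using finite_imp_inj_to_nat_seg by metis
    then show ?thesis unfolding h_def by (rule someI[where P = "\<lambda>f. inj_on f {j \<in> J. x j = x i}"])
  qed
  define g where "g j = (x j, h (x j) j)" for j
  have inj: "inj_on g J0"
  proof (rule inj_onI)
    fix i j assume ij: "i \<in> J0" "j \<in> J0" "g i = g j"
    then have "x j = x i" "h (x i) i = h (x i) j" by (auto simp: g_def)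
    then show "i = j"
      using ij by (intro inj_onD[OF h[OF ij(1)]]) (auto simp: J0_def)
  qed
  have zero_inner: "hinner X y (hzero X) = 0" if "y \<in> hcarrier X" for y
    using inner_add_right[OF that zero_closed zero_closed] add_zero[OF zero_closed] by simp
  have sums: "ultraweak_has_sum ?A
       (\<lambda>j. bidual_embed ?A (hinner X y (fst j) o\<^sub>L hinner X (fst j) y)) S (g ` J0)"
    if y: "y \<in> hcarrier X"
      and S: "ultraweak_has_sum ?A (\<lambda>j. bidual_embed ?A (hinner X y (x j) o\<^sub>L hinner X (x j) y)) S J"
    for y S
    unfolding ultraweak_has_sum_def
  proof (intro conjI ballI)
    show "S \<in> bidual ?A" using S by (simp add: ultraweak_has_sum_def)
    fix \<phi> assume \<phi>: "\<phi> \<in> dual ?A"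
    have "scalar_op 0 o\<^sub>L scalar_op 0 = 0"
      unfolding scalar_op_mult by (rule blinfun_eqI) (simp add: scalar_op.rep_eq, transfer, simp)
    moreover have "\<phi> (scalar_op 0 o\<^sub>L scalar_op 0) = 0"
      using \<phi> scalar_in_cps by (simp add: dual_def)
    ultimately have \<phi>0: "\<phi> 0 = 0" by simp
    let ?t = "\<lambda>y z. bidual_embed ?A (hinner X y z o\<^sub>L hinner X z y) \<phi>"
    have "((\<lambda>j. ?t y (x j)) has_sum S \<phi>) J"
      using S \<phi> by (simp add: ultraweak_has_sum_def)
    moreover have "?t y (hzero X) = 0"
      using y \<phi> \<phi>0 by (simp add: bidual_embed_def cutoff_def zero_inner)
    ultimately have "((\<lambda>j. ?t y (x j)) has_sum S \<phi>) J0"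
      by (subst has_sum_cong_neutral[of J J0 _ "\<lambda>j. ?t y (x j)"]) (auto simp: J0_def)
    then show "((\<lambda>j. ?t y (fst j)) has_sum S \<phi>) (g ` J0)"
      by (subst has_sum_reindex[OF inj]) (simp add: o_def g_def)
  qed
  have "is_frame ?A X (g ` J0) fst"
    unfolding is_frame_def
  proof (intro conjI)
    show "\<forall>j\<in>g ` J0. fst j \<in> hcarrier X" using xc by (auto simp: g_def J0_def)
    show "\<exists>C>0. \<exists>D>0. \<forall>y\<in>hcarrier X. \<exists>S.
        ultraweak_has_sum ?A (\<lambda>j. bidual_embed ?A (hinner X y (fst j) o\<^sub>L hinner X (fst j) y)) S (g ` J0) \<and>
        bidual_le ?A (\<lambda>\<phi>. complex_of_real C * bidual_embed ?A (hinner X y y) \<phi>) S \<and>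
        bidual_le ?A S (\<lambda>\<phi>. complex_of_real D * bidual_embed ?A (hinner X y y) \<phi>)"
    proof (rule exI[of _ C], rule conjI[OF C], rule exI[of _ D], rule conjI[OF D], rule ballI)
      fix y assume y: "y \<in> hcarrier X"
      show "\<exists>S.
        ultraweak_has_sum ?A (\<lambda>j. bidual_embed ?A (hinner X y (fst j) o\<^sub>L hinner X (fst j) y)) S (g ` J0) \<and>
        bidual_le ?A (\<lambda>\<phi>. complex_of_real C * bidual_embed ?A (hinner X y y) \<phi>) S \<and>
        bidual_le ?A S (\<lambda>\<phi>. complex_of_real D * bidual_embed ?A (hinner X y y) \<phi>)"
        using CD[OF y] sums[OF y] by (elim exE conjE) (intro exI conjI; assumption?)
    qed
  qed
  then show ?thesis unfolding possesses_frame_def by blast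
qed

end

theory Submission
  imports Defs
begin

text \<open>
  Write \<open>A\<close> for the algebra of compact operators plus scalars and \<open>\<chi>\<close> for its character with kernel
  the compact operators. Two kinds of states of \<open>A\<close> are played off against each other: the vector
  states, which come from a separable Hilbert space, and \<open>\<chi>\<close>. A module is built that is separable
  for the former and not for the latter.

  The full binary tree has countably many nodes but uncountably many infinite paths, and two distinct
  paths share only finitely many nodes. For a path \<open>t\<close> let \<open>V\<^sub>t\<close> be the isometry of the sequence space
  onto the closed span of the nodes of \<open>t\<close>. Then \<open>V\<^sub>t\<^sup>* V\<^sub>t = 1\<close>, while \<open>V\<^sub>s\<^sup>* V\<^sub>t\<close> has finite rank for
  distinct \<open>s\<close> and \<open>t\<close> (\<open>branch_product_same\<close>, \<open>branch_product_distinct\<close>). Let \<open>X\<close> be the norm closure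
  of the span of all \<open>V\<^sub>t\<close> and all compact operators, with \<open>\<langle>x, y\<rangle> = x\<^sup>* y\<close>. These inner products lie
  in \<open>A\<close>, because \<open>A\<close> is norm closed (\<open>cps_limit\<close>), and \<open>X\<close> is a Hilbert module
  (\<open>hilbert_module_branch_module\<close>).

  Suppose that \<open>x\<^sub>j\<close> is a frame of \<open>X\<close>. Evaluating the frame sums of rank-one operators at vector
  states gives convergent sums of the numbers \<open>\<parallel>x\<^sub>j\<^sup>* e\<^sub>n\<parallel>\<^sup>2\<close> for each \<open>n\<close>. Each sum has only countably many
  nonzero terms, so only countably many \<open>x\<^sub>j\<close> are nonzero (\<open>ultraweak_sum_countable\<close>). On the other
  hand each element \<open>x\<close> of \<open>X\<close> has \<open>\<chi>(V\<^sub>t\<^sup>* x) \<noteq> 0\<close> for only countably many \<open>t\<close>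
  (\<open>countable_branch_coefficients\<close>). As there are uncountably many paths, some \<open>t\<close> satisfies
  \<open>\<chi>(V\<^sub>t\<^sup>* x\<^sub>j) = 0\<close> for all \<open>j\<close>. At \<open>\<chi>\<close>, which is positive on the bidual
  (\<open>character_Arens_square\<close>), the lower frame bound for \<open>V\<^sub>t\<close> then reads \<open>C \<le> 0\<close>, a contradiction.
\<close>


section \<open>Completeness of the sequence space\<close>

text \<open>A Cauchy sequence \<open>z\<close> yields the bounded functional \<open>y \<mapsto> lim \<langle>z n, y\<rangle>\<close>; the vector that represents
  it is the limit of \<open>z\<close>.\<close>

lemma l2_Cauchy_convergent:
  fixes z :: "nat \<Rightarrow> l2"
  assumes "Cauchy z"
  shows "convergent z"
proof -
  have diff: "cinner u y - cinner v y = cinner (u - v) y" for u v y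
    using cinner_add_left[of "u - v" v y] by simp
  have "convergent (\<lambda>n. cinner (z n) y)" for y
  proof (rule Cauchy_convergent, rule metric_CauchyI)
    fix e :: real assume e: "e > 0"
    define d where "d = e / (norm y + 1)"
    have ny: "norm y + 1 > 0" using norm_ge_zero[of y] by linarith
    have d: "d > 0" using e ny by (simp add: d_def)
    obtain N where N: "\<And>m n. m \<ge> N \<Longrightarrow> n \<ge> N \<Longrightarrow> norm (z m - z n) < d"
      using assms d unfolding Cauchy_def dist_norm by blast
    show "\<exists>N. \<forall>m\<ge>N. \<forall>n\<ge>N. dist (cinner (z m) y) (cinner (z n) y) < e"
    proof (intro exI allI impI)
      fix m n assume "m \<ge> N" "n \<ge> N"
      have "cmod (cinner (z m - z n) y) \<le> norm (z m - z n) * norm y"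
        by (rule cinner_Cauchy_Schwarz)
      also have "\<dots> \<le> d * norm y"
        using N[OF \<open>m \<ge> N\<close> \<open>n \<ge> N\<close>] by (intro mult_right_mono) auto
      also have "\<dots> < d * (norm y + 1)" using d by simp
      also have "\<dots> = e" using ny by (simp add: d_def)
      finally show "dist (cinner (z m) y) (cinner (z n) y) < e" by (simp add: dist_norm diff)
    qed
  qed
  then obtain \<phi> where \<phi>: "\<And>y. (\<lambda>n. cinner (z n) y) \<longlonglongrightarrow> \<phi> y"
    unfolding convergent_def by metis
  obtain B where B: "\<And>n. norm (z n) \<le> B"
    using cauchy_imp_bounded[OF assms] unfolding bounded_iff by auto
  obtain w where w: "\<And>y. \<phi> y = cinner w y"
  proof (rule exE[OF riesz_l2[of \<phi> B]])
    show "\<phi> (x + y) = \<phi> x + \<phi> y" for x y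
      by (rule LIMSEQ_unique[OF \<phi>]) (simp add: cinner_add_right tendsto_add \<phi>)
    show "\<phi> (cscale c x) = c * \<phi> x" for c x
      by (rule LIMSEQ_unique[OF \<phi>]) (simp add: cinner_cscale_right tendsto_mult \<phi>)
    show "cmod (\<phi> y) \<le> B * norm y" for y
    proof (rule Lim_bounded[OF tendsto_norm[OF \<phi>]])
      show "\<forall>n\<ge>0. cmod (cinner (z n) y) \<le> B * norm y"
        using cinner_Cauchy_Schwarz[of "z _" y] mult_right_mono[OF B norm_ge_zero[of y]]
        by (blast intro: order_trans)
    qed
  qed blast
  have "z \<longlonglongrightarrow> w"
  proof (rule metric_LIMSEQ_I)
    fix e :: real assume "e > 0"
    then obtain N where N: "\<And>m n. m \<ge> N \<Longrightarrow> n \<ge> N \<Longrightarrow> norm (z m - z n) < e / 2"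
      using assms unfolding Cauchy_def dist_norm by (metis half_gt_zero)
    have "norm (z n - w) \<le> e / 2" if n: "n \<ge> N" for n
    proof -
      let ?y = "z n - w"
      have "(\<lambda>m. cinner (z n - z m) ?y) \<longlonglongrightarrow> cinner ?y ?y"
        unfolding diff[symmetric] using \<phi>[of ?y] w[of ?y] by (intro tendsto_intros) simp
      then have "cmod (cinner ?y ?y) \<le> e / 2 * norm ?y"
      proof (rule Lim_bounded[OF tendsto_norm])
        show "\<forall>m\<ge>N. cmod (cinner (z n - z m) ?y) \<le> e / 2 * norm ?y"
          using cinner_Cauchy_Schwarz[of "z n - z _" ?y]
            mult_right_mono[OF less_imp_le[OF N[OF n]] norm_ge_zero[of ?y]]
          by (blast intro: order_trans)
      qed
      then have "norm ?y * norm ?y \<le> e / 2 * norm ?y"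
        unfolding cinner_self by (simp add: power2_eq_square norm_mult)
      then show ?thesis
        using \<open>e > 0\<close> by (cases "norm ?y = 0") (auto dest: mult_right_le_imp_le)
    qed
    then show "\<exists>N. \<forall>n\<ge>N. dist (z n) w < e"
      using \<open>e > 0\<close> unfolding dist_norm by (intro exI[of _ N]) fastforce
  qed
  then show ?thesis unfolding convergent_def by blast
qed

instance l2 :: banach
  by standard (rule l2_Cauchy_convergent)


section \<open>The C*-algebra of complex-linear operators\<close>

lemma cinner_eqI_left: "(\<And>y. cinner u y = cinner v y) \<Longrightarrow> u = v"
  by (rule cinner_eqI) (metis cinner_commute)

lemma adj_eqI:
  fixes S T :: "l2 \<Rightarrow>\<^sub>L l2"
  assumes "clinear_op T" "\<And>x y. cinner (S x) y = cinner x (T y)"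
  shows "adj T = S"
  by (rule blinfun_eqI, rule cinner_eqI_left) (simp add: assms cinner_adj)

lemma clinear_adj:
  assumes "clinear_op T"
  shows "clinear_op (adj T)"
  unfolding clinear_op_def
  by (intro allI cinner_eqI_left) (simp add: cinner_adj[OF assms] cinner_cscale_left)

lemma cinner_adj_right:
  assumes "clinear_op T"
  shows "cinner x (adj T y) = cinner (T x) y"
  by (metis assms cinner_adj cinner_commute)

lemma adj_adj: "clinear_op T \<Longrightarrow> adj (adj T) = T"
  by (rule adj_eqI) (simp_all add: clinear_adj cinner_adj_right)

lemma adj_add: "clinear_op S \<Longrightarrow> clinear_op T \<Longrightarrow> adj (S + T) = adj S + adj T"
  by (rule adj_eqI)
    (simp_all add: clinear_op_add plus_blinfun.rep_eq cinner_add_left cinner_add_right cinner_adj)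

lemma adj_comp: "clinear_op S \<Longrightarrow> clinear_op T \<Longrightarrow> adj (S o\<^sub>L T) = adj T o\<^sub>L adj S"
  by (rule adj_eqI) (simp_all add: clinear_op_comp cinner_adj)

lemma adj_scalar_op: "adj (scalar_op c) = scalar_op (cnj c)"
  by (rule adj_eqI)
    (simp_all add: clinear_scalar_op scalar_op.rep_eq cinner_cscale_left cinner_cscale_right)

lemma cscale_0: "cscale 0 x = 0"
  using cscale_of_real[of 0 x] by simp

lemma cscale_1: "cscale 1 x = x"
  using cscale_of_real[of 1 x] by simp

lemma cscale_minus_1: "cscale (- 1) x = - x"
  using cscale_of_real[of "- 1" x] by simp

lemma scalar_op_0: "scalar_op 0 = 0"
  by (rule blinfun_eqI) (simp add: scalar_op.rep_eq cscale_0)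

lemma clinear_op_0: "clinear_op 0"
  using clinear_scalar_op[of 0] by (simp add: scalar_op_0)

lemma scalar_op_1: "scalar_op 1 o\<^sub>L T = T"
  by (rule blinfun_eqI) (simp add: scalar_op.rep_eq cscale_1)

lemma scalar_op_minus_1: "scalar_op (- 1) o\<^sub>L T = - T"
  by (rule blinfun_eqI) (simp add: scalar_op.rep_eq cscale_minus_1 uminus_blinfun.rep_eq)

lemma scalar_op_comp_commute: "clinear_op T \<Longrightarrow> T o\<^sub>L scalar_op c = scalar_op c o\<^sub>L T"
  by (rule blinfun_eqI) (simp add: clinear_op_def scalar_op.rep_eq)

lemma clinear_op_diff:
  assumes "clinear_op S" "clinear_op T"
  shows "clinear_op (S - T)"
  using clinear_op_add[OF assms(1) clinear_op_comp[OF clinear_scalar_op assms(2)], of "- 1"]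
  by (simp add: scalar_op_minus_1)

lemma norm_cinner_self: "cmod (cinner x x) = (norm x)\<^sup>2"
  unfolding cinner_self by (simp only: norm_of_real abs_power2)

text \<open>The inequality \<open>\<parallel>T x\<parallel>\<^sup>2 = \<langle>T\<^sup>* T x, x\<rangle> \<le> \<parallel>T\<^sup>* T\<parallel> \<parallel>x\<parallel>\<^sup>2\<close> gives one
  half. It also implies \<open>\<parallel>T\<parallel> \<le> \<parallel>T\<^sup>*\<parallel>\<close>, and the same for \<open>T\<^sup>*\<close> gives the other half. The identity makes
  the norm of the module constructed below the operator norm, so that completeness is inherited from
  the space of bounded operators.\<close>

lemma cstar_identity:
  assumes T: "clinear_op T"
  shows "norm (adj T o\<^sub>L T) = (norm T)\<^sup>2"
proof (rule antisym)
  have le: "(norm (S x))\<^sup>2 \<le> norm (adj S o\<^sub>L S) * (norm x)\<^sup>2" if S: "clinear_op S" for S x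
  proof -
    have "(norm (S x))\<^sup>2 = cmod (cinner (adj S (S x)) x)"
      unfolding cinner_adj[OF S] norm_cinner_self ..
    also have "\<dots> \<le> norm ((adj S o\<^sub>L S) x) * norm x" using cinner_Cauchy_Schwarz by simp
    also have "\<dots> \<le> (norm (adj S o\<^sub>L S) * norm x) * norm x"
      by (intro mult_right_mono norm_blinfun) auto
    finally show ?thesis by (simp add: power2_eq_square mult.assoc)
  qed
  have bd: "(norm S)\<^sup>2 \<le> norm (adj S o\<^sub>L S)" if S: "clinear_op S" for S
  proof -
    have "norm S \<le> sqrt (norm (adj S o\<^sub>L S))"
      by (rule norm_blinfun_bound)
        (use real_sqrt_le_mono[OF le[OF S]] in \<open>auto simp: real_sqrt_mult\<close>)
    then show ?thesis by (metis norm_ge_zero power_mono real_sqrt_pow2)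
  qed
  have half: "norm S \<le> norm (adj S)" if S: "clinear_op S" for S
  proof -
    have "norm S * norm S \<le> norm (adj S) * norm S"
      using bd[OF S] norm_blinfun_compose[of "adj S" S] by (simp add: power2_eq_square)
    then show ?thesis by (cases "norm S = 0") (auto dest: mult_right_le_imp_le)
  qed
  show "(norm T)\<^sup>2 \<le> norm (adj T o\<^sub>L T)" by (rule bd[OF T])
  have "norm (adj T) \<le> norm T" using half[OF clinear_adj[OF T]] by (simp add: adj_adj[OF T])
  then have "norm (adj T) * norm T \<le> (norm T)\<^sup>2"
    unfolding power2_eq_square by (intro mult_right_mono) auto
  then show "norm (adj T o\<^sub>L T) \<le> (norm T)\<^sup>2"
    using norm_blinfun_compose[of "adj T" T] by linarith
qed

lemma norm_adj_le:
  assumes T: "clinear_op T"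
  shows "norm (adj T) \<le> norm T"
proof -
  have "(norm (adj T))\<^sup>2 \<le> norm T * norm (adj T)"
    using cstar_identity[OF clinear_adj[OF T]] norm_blinfun_compose[of T "adj T"]
    by (simp add: adj_adj[OF T])
  then show ?thesis
    by (cases "norm (adj T) = 0") (auto simp: power2_eq_square dest: mult_right_le_imp_le)
qed

lemma tendsto_adj:
  assumes u: "\<And>n. clinear_op (u n)" and T: "clinear_op T" and "u \<longlonglongrightarrow> T"
  shows "(\<lambda>n. adj (u n)) \<longlonglongrightarrow> adj T"
proof (rule LIM_zero_cancel, rule Lim_null_comparison)
  have "adj (u n) - adj T = adj (u n - T)" for n
    using adj_add[OF clinear_op_diff[OF u[of n] T] T] by (simp add: algebra_simps)
  then show "\<forall>\<^sub>F n in sequentially. norm (adj (u n) - adj T) \<le> norm (u n - T)"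
    using u T by (simp add: norm_adj_le clinear_op_diff)
  show "(\<lambda>n. norm (u n - T)) \<longlonglongrightarrow> 0"
    using assms(3) by (intro tendsto_norm_zero LIM_zero)
qed

lemma tendsto_blinfun_compose [tendsto_intros]:
  assumes "(S \<longlongrightarrow> S') F" "(T \<longlongrightarrow> T') F"
  shows "((\<lambda>n. S n o\<^sub>L T n) \<longlongrightarrow> (S' o\<^sub>L T')) F"
  by (rule bounded_bilinear.tendsto[OF bounded_bilinear_blinfun_compose assms])

text \<open>Complex linearity is commutation with the scalar operators, an equation between continuous
  functions of the operator.\<close>

lemma clinear_op_limit:
  assumes u: "\<And>n. clinear_op (u n)" and lim: "u \<longlonglongrightarrow> T"
  shows "clinear_op T"
proof -
  have "T o\<^sub>L scalar_op c = scalar_op c o\<^sub>L T" for c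
  proof (rule LIMSEQ_unique)
    show "(\<lambda>n. u n o\<^sub>L scalar_op c) \<longlonglongrightarrow> (T o\<^sub>L scalar_op c)"
      by (intro tendsto_intros lim)
    show "(\<lambda>n. u n o\<^sub>L scalar_op c) \<longlonglongrightarrow> (scalar_op c o\<^sub>L T)"
      unfolding scalar_op_comp_commute[OF u] by (intro tendsto_intros lim)
  qed
  then show ?thesis
    unfolding clinear_op_def by (metis blinfun_apply_blinfun_compose scalar_op.rep_eq)
qed


section \<open>Compact operators\<close>

lemma cscale_add_left: "cscale (c + d) x = cscale c x + cscale d x"
  using scalar_op_add[of c d] by (metis plus_blinfun.rep_eq scalar_op.rep_eq)

lemma cscale_cscale: "cscale c (cscale d x) = cscale (c * d) x"
  using scalar_op_mult[of c d] by (metis blinfun_apply_blinfun_compose scalar_op.rep_eq)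

lemma bounded_linear_cscale_left: "bounded_linear (\<lambda>c. cscale c x)"
proof (rule bounded_linear_intro)
  show "cscale (c + d) x = cscale c x + cscale d x" for c d by (rule cscale_add_left)
  show "cscale (r *\<^sub>R c) x = r *\<^sub>R cscale c x" for r c
    unfolding scaleR_conv_of_real cscale_cscale[symmetric] by (rule cscale_of_real)
  show "norm (cscale c x) \<le> norm c * norm x" for c by (simp add: norm_cscale)
qed

lemma compact_opI_totally_bounded:
  assumes "clinear_op T"
    and cover: "\<And>e. e > 0 \<Longrightarrow> \<exists>k. finite k \<and> T ` cball 0 1 \<subseteq> (\<Union>x\<in>k. ball x e)"
  shows "compact_op T"
  unfolding compact_op_def compact_eq_totally_bounded
proof (intro conjI allI impI)
  show "complete (closure (T ` cball 0 1))" by (simp add: complete_eq_closed)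
  fix e :: real assume "e > 0"
  then obtain k where k: "finite k" "T ` cball 0 1 \<subseteq> (\<Union>x\<in>k. ball x (e / 2))"
    using cover[of "e / 2"] by auto
  have "closure (T ` cball 0 1) \<subseteq> (\<Union>x\<in>k. cball x (e / 2))"
  proof (rule closure_minimal)
    show "T ` cball 0 1 \<subseteq> (\<Union>x\<in>k. cball x (e / 2))"
      using k(2) by (rule order_trans) (intro UN_mono ball_subset_cball order_refl)
    show "closed (\<Union>x\<in>k. cball x (e / 2))" using k(1) by (intro closed_UN) auto
  qed
  also have "\<dots> \<subseteq> (\<Union>x\<in>k. ball x e)"
    using \<open>e > 0\<close> by (intro UN_mono order_refl) auto
  finally show "\<exists>k. finite k \<and> closure (T ` cball 0 1) \<subseteq> (\<Union>x\<in>k. ball x e)"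
    using k(1) by blast
qed (rule assms)

lemma compact_op_totally_bounded:
  assumes "compact_op T" "e > 0"
  shows "\<exists>k. finite k \<and> T ` cball 0 1 \<subseteq> (\<Union>x\<in>k. ball x e)"
proof -
  obtain k where "finite k" "closure (T ` cball 0 1) \<subseteq> (\<Union>x\<in>k. ball x e)"
    using assms unfolding compact_op_def compact_eq_totally_bounded by blast
  then show ?thesis using closure_subset[of "T ` cball 0 1"] by blast
qed

lemma compact_op_clinear: "compact_op K \<Longrightarrow> clinear_op K"
  by (simp add: compact_op_def)

text \<open>A finite net for the image of the ball under a nearby compact operator is, at a coarser scale, a
  net for the image under the limit.\<close>

lemma compact_op_limit:
  assumes K: "\<And>n. compact_op (K n)" and lim: "K \<longlonglongrightarrow> T"
  shows "compact_op T"
proof (rule compact_opI_totally_bounded)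
  show "clinear_op T"
    by (rule clinear_op_limit[OF compact_op_clinear[OF K] lim])
  fix e :: real assume e: "e > 0"
  obtain n where n: "norm (K n - T) < e / 2"
    using LIMSEQ_D[OF lim half_gt_zero[OF e]] by blast
  obtain k where k: "finite k" "K n ` cball 0 1 \<subseteq> (\<Union>x\<in>k. ball x (e / 2))"
    using compact_op_totally_bounded[OF K[of n] half_gt_zero[OF e]] by blast
  have "T ` cball 0 1 \<subseteq> (\<Union>y\<in>k. ball y e)"
  proof (rule image_subsetI)
    fix x :: l2 assume x: "x \<in> cball 0 1"
    have "K n x \<in> (\<Union>x\<in>k. ball x (e / 2))" by (rule subsetD[OF k(2) imageI[OF x]])
    then obtain y where y: "y \<in> k" "dist y (K n x) < e / 2" by auto
    have "norm ((K n - T) x) \<le> norm (K n - T) * norm x" by (rule norm_blinfun)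
    also have "\<dots> \<le> norm (K n - T) * 1" using x by (intro mult_left_mono) auto
    finally have "norm (K n x - T x) < e / 2"
      using n unfolding minus_blinfun.rep_eq by linarith
    then have "dist y (T x) < e"
      using y(2) dist_triangle[of y "T x" "K n x"] unfolding dist_norm by linarith
    then show "T x \<in> (\<Union>y\<in>k. ball y e)" using y(1) by auto
  qed
  with k(1) show "\<exists>k. finite k \<and> T ` cball 0 1 \<subseteq> (\<Union>x\<in>k. ball x e)" by blast
qed

lift_definition rank_one :: "l2 \<Rightarrow> l2 \<Rightarrow> (l2 \<Rightarrow>\<^sub>L l2)" is "\<lambda>u v x. cscale (cinner v x) u"
proof (rule bounded_linear_intro)
  fix u v :: l2
  show "cscale (cinner v (x + y)) u = cscale (cinner v x) u + cscale (cinner v y) u" for x y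
    by (simp add: cinner_add_right cscale_add_left)
  show "cscale (cinner v (r *\<^sub>R x)) u = r *\<^sub>R cscale (cinner v x) u" for r x
    unfolding cinner_scaleR_right cscale_cscale[symmetric] by (rule cscale_of_real)
  show "norm (cscale (cinner v x) u) \<le> norm x * (norm v * norm u)" for x
    using mult_right_mono[OF cinner_Cauchy_Schwarz norm_ge_zero, of v x u]
    by (simp add: norm_cscale mult_ac)
qed

lemma compact_op_rank_one: "compact_op (rank_one u v)"
proof (rule compact_opI)
  show "clinear_op (rank_one u v)"
    by (simp add: clinear_op_def rank_one.rep_eq cinner_cscale_right cscale_cscale)
  show "compact ((\<lambda>c. cscale c u) ` cball 0 (norm v))"
    by (intro compact_continuous_image linear_continuous_on bounded_linear_cscale_left) simp
  show "rank_one u v ` cball 0 1 \<subseteq> (\<lambda>c. cscale c u) ` cball 0 (norm v)"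
  proof (rule image_subsetI)
    fix x :: l2 assume "x \<in> cball 0 1"
    then have "norm v * norm x \<le> norm v" by (simp add: mult_left_le)
    then have "cmod (cinner v x) \<le> norm v" by (rule order_trans[OF cinner_Cauchy_Schwarz])
    then show "rank_one u v x \<in> (\<lambda>c. cscale c u) ` cball 0 (norm v)"
      by (simp add: rank_one.rep_eq)
  qed
qed

definition unit_vec :: "nat \<Rightarrow> l2" where
  "unit_vec n = trunc (Suc n) (\<lambda>m. if m = n then 1 else 0)"

lemma coord_unit_vec: "coord (unit_vec n) m = (if m = n then 1 else 0)"
  by (simp add: unit_vec_def trunc.rep_eq)

lemma cinner_unit_vec: "cinner (unit_vec n) y = coord y n"
proof -
  have "cinner (unit_vec n) y = (\<Sum>m<Suc n. if m = n then coord y m else 0)"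
    unfolding unit_vec_def cinner_trunc by (rule sum.cong) auto
  then show ?thesis by simp
qed

lemma norm_unit_vec: "norm (unit_vec n) = 1"
proof -
  have "cmod (cinner (unit_vec n) (unit_vec n)) = 1"
    by (simp add: cinner_unit_vec coord_unit_vec)
  then have "(norm (unit_vec n))\<^sup>2 = 1" by (simp add: norm_cinner_self)
  then show ?thesis by (rule power2_eq_imp_eq[of _ 1, simplified]) simp
qed

lemma norm_trunc_le: "norm (trunc N (coord x)) \<le> norm x"
proof -
  have "(\<Sum>n<N. (cmod (coord x n))\<^sup>2) \<le> (\<Sum>n. (cmod (coord x n))\<^sup>2)"
    by (rule sum_le_suminf[OF sums_summable[OF norm_l2_sums]]) auto
  then have "(norm (trunc N (coord x)))\<^sup>2 \<le> (norm x)\<^sup>2"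
    by (simp add: norm_trunc sums_unique[OF norm_l2_sums, symmetric])
  then show ?thesis by (rule power2_le_imp_le) simp
qed

lift_definition proj :: "nat \<Rightarrow> (l2 \<Rightarrow>\<^sub>L l2)" is "\<lambda>N x. trunc N (coord x)"
proof (rule bounded_linear_intro)
  fix N :: nat
  show "trunc N (coord (x + y)) = trunc N (coord x) + trunc N (coord y)" for x y
    unfolding coord_inject[symmetric] fun_eq_iff plus_l2.rep_eq trunc.rep_eq by simp
  show "trunc N (coord (r *\<^sub>R x)) = r *\<^sub>R trunc N (coord x)" for r x
    unfolding coord_inject[symmetric] fun_eq_iff scaleR_l2.rep_eq trunc.rep_eq by simp
  show "norm (trunc N (coord x)) \<le> norm x * 1" for x
    using norm_trunc_le by simp
qed

lemma coord_proj: "coord (proj N x) n = (if n < N then coord x n else 0)"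
  by (simp add: proj.rep_eq trunc.rep_eq)

lemma norm_proj_le: "norm (proj N x) \<le> norm x"
  by (simp add: proj.rep_eq norm_trunc_le)

lemma clinear_proj: "clinear_op (proj N)"
  unfolding clinear_op_def coord_inject[symmetric] fun_eq_iff cscale.rep_eq coord_proj by simp

lemma compact_op_0: "compact_op 0"
  by (rule compact_opI[of _ "{0}"]) (auto simp: clinear_op_0)

lemma compact_op_proj: "compact_op (proj N)"
proof (induction N)
  case 0
  have "proj 0 = 0" by (rule blinfun_eqI) (simp add: proj.rep_eq trunc_0)
  then show ?case by (simp add: compact_op_0)
next
  case (Suc N)
  have "proj (Suc N) = proj N + rank_one (unit_vec N) (unit_vec N)"
  proof (rule blinfun_eqI)
    show "proj (Suc N) x = (proj N + rank_one (unit_vec N) (unit_vec N)) x" for x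
      using trunc_Suc[of N "coord x"]
      by (simp add: proj.rep_eq plus_blinfun.rep_eq rank_one.rep_eq cinner_unit_vec
          unit_vec_def[of N, symmetric])
  qed
  then show ?case using Suc by (simp add: compact_op_add compact_op_rank_one)
qed

lemma adj_proj: "adj (proj N) = proj N"
proof (rule adj_eqI[OF clinear_proj])
  show "cinner (proj N x) y = cinner x (proj N y)" for x y
    unfolding cinner_def by (rule suminf_cong) (simp add: coord_proj)
qed

text \<open>The truncations converge strongly to the identity, hence uniformly on the relatively compact
  image of the unit ball. Together with \<open>compact_op_limit\<close> this makes the compact operators exactly
  the norm limits of their truncations, a description that passes to adjoints.\<close>

lemma compact_op_truncations:
  assumes K: "compact_op K"
  shows "(\<lambda>N. proj N o\<^sub>L K) \<longlonglongrightarrow> K"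
proof (rule metric_LIMSEQ_I)
  fix e :: real assume e: "e > 0"
  then have "e / 6 > 0" by simp
  from compact_op_totally_bounded[OF K this]
  obtain k where k: "finite k" "K ` cball 0 1 \<subseteq> (\<Union>y\<in>k. ball y (e / 6))"
    by blast
  have "\<forall>\<^sub>F N in sequentially. \<forall>y\<in>k. norm (proj N y - y) < e / 6"
  proof (rule eventually_ball_finite[OF k(1)], rule ballI)
    fix y assume "y \<in> k"
    show "\<forall>\<^sub>F N in sequentially. norm (proj N y - y) < e / 6"
      using tendstoD[OF trunc_tendsto[of y], of "e / 6"] e by (simp add: proj.rep_eq dist_norm)
  qed
  then obtain N0 where N0: "\<And>N y. N \<ge> N0 \<Longrightarrow> y \<in> k \<Longrightarrow> norm (proj N y - y) < e / 6"
    unfolding eventually_sequentially by blast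
  have ball: "norm (proj N (K x) - K x) \<le> e / 2" if N: "N \<ge> N0" and x: "norm x \<le> 1" for N x
  proof -
    have "K x \<in> (\<Union>y\<in>k. ball y (e / 6))" using x by (intro subsetD[OF k(2)] imageI) simp
    then obtain y where y: "y \<in> k" "norm (y - K x) < e / 6"
      unfolding dist_norm[symmetric] by auto
    have "proj N (K x) - K x = (y - K x) + (proj N y - y) - proj N (y - K x)"
      by (simp add: blinfun.diff_right)
    also have "norm \<dots> \<le> norm (y - K x) + norm (proj N y - y) + norm (proj N (y - K x))"
      by (intro norm_triangle_le_diff add_mono norm_triangle_ineq order_refl)
    finally show ?thesis using norm_proj_le[of N "y - K x"] y N0[OF N y(1)] by linarith
  qed
  have "norm ((proj N o\<^sub>L K) - K) \<le> e / 2" if N: "N \<ge> N0" for N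
  proof (rule norm_blinfun_bound)
    show "norm (((proj N o\<^sub>L K) - K) x) \<le> e / 2 * norm x" for x
    proof (cases "x = 0")
      case False
      have "norm (proj N (K (x /\<^sub>R norm x)) - K (x /\<^sub>R norm x)) \<le> e / 2"
        using False by (intro ball N) simp
      then have "norm ((proj N (K x) - K x) /\<^sub>R norm x) \<le> e / 2"
        unfolding blinfun.scaleR_right scaleR_diff_right .
      then have "norm (proj N (K x) - K x) / norm x \<le> e / 2"
        unfolding norm_scaleR divide_inverse[of "norm (proj N (K x) - K x)"] abs_inverse abs_norm_cancel
        by (subst mult.commute)
      then have "norm (proj N (K x) - K x) \<le> e / 2 * norm x"
        using False pos_divide_le_eq[of "norm x"] by simp
      then show ?thesis by (simp add: minus_blinfun.rep_eq)
    qed simp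
  qed (use e in simp)
  then show "\<exists>N0. \<forall>N\<ge>N0. dist (proj N o\<^sub>L K) K < e"
    using e by (intro exI[of _ N0]) (fastforce simp: dist_norm)
qed

lemma compact_op_adj:
  assumes K: "compact_op K"
  shows "compact_op (adj K)"
proof (rule compact_op_limit)
  have cl: "clinear_op K" using K by (simp add: compact_op_def)
  show "compact_op (adj (proj N o\<^sub>L K))" for N
    unfolding adj_comp[OF clinear_proj cl] adj_proj
    by (intro compact_op_comp_left clinear_adj cl compact_op_proj)
  show "(\<lambda>N. adj (proj N o\<^sub>L K)) \<longlonglongrightarrow> adj K"
    by (intro tendsto_adj clinear_op_comp clinear_proj cl compact_op_truncations K)
qed


section \<open>The character of the compact operators plus scalars\<close>

lemma compact_op_diagonal:
  assumes K: "compact_op K"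
  shows "(\<lambda>n. cinner (unit_vec n) (K (unit_vec n))) \<longlonglongrightarrow> 0"
proof (rule metric_LIMSEQ_I)
  fix e :: real assume "e > 0"
  then obtain N where N: "norm ((proj N o\<^sub>L K) - K) < e"
    using LIMSEQ_D[OF compact_op_truncations[OF K]] by blast
  show "\<exists>N. \<forall>n\<ge>N. dist (cinner (unit_vec n) (K (unit_vec n))) 0 < e"
  proof (intro exI[of _ N] allI impI)
    fix n assume "n \<ge> N"
    then have "cinner (unit_vec n) (K (unit_vec n)) = - cinner (unit_vec n) (((proj N o\<^sub>L K) - K) (unit_vec n))"
      by (simp add: minus_blinfun.rep_eq cinner_diff_right cinner_unit_vec coord_proj)
    then have "cmod (cinner (unit_vec n) (K (unit_vec n))) \<le> norm (((proj N o\<^sub>L K) - K) (unit_vec n))"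
      using cinner_Cauchy_Schwarz[of "unit_vec n"] by (simp add: norm_unit_vec del: blinfun_apply_blinfun_compose)
    also have "\<dots> \<le> norm ((proj N o\<^sub>L K) - K)"
      using norm_blinfun[of "(proj N o\<^sub>L K) - K" "unit_vec n"] by (simp add: norm_unit_vec)
    finally show "dist (cinner (unit_vec n) (K (unit_vec n))) 0 < e" using N by simp
  qed
qed

text \<open>The diagonal matrix entries of \<open>K + c\<close>, with \<open>K\<close> compact, tend to \<open>c\<close>. So this limit is the
  quotient map of the algebra by the ideal of compact operators.\<close>

definition scalar_part :: "(l2 \<Rightarrow>\<^sub>L l2) \<Rightarrow> complex" where
  "scalar_part a = lim (\<lambda>n. cinner (unit_vec n) (a (unit_vec n)))"

lemma cpsE:
  assumes "a \<in> compact_plus_scalars"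
  obtains K c where "compact_op K" "a = K + scalar_op c"
  using assms unfolding compact_plus_scalars_def by blast

lemma cpsI: "compact_op K \<Longrightarrow> K + scalar_op c \<in> compact_plus_scalars"
  unfolding compact_plus_scalars_def by blast

lemma compact_in_cps: "compact_op K \<Longrightarrow> K \<in> compact_plus_scalars"
  using cpsI[of K 0] by (simp add: scalar_op_0)

lemma scalar_part_diagonal:
  assumes K: "compact_op K"
  shows "(\<lambda>n. cinner (unit_vec n) ((K + scalar_op c) (unit_vec n))) \<longlonglongrightarrow> c"
proof -
  have "(\<lambda>n. cinner (unit_vec n) (K (unit_vec n)) + c) \<longlonglongrightarrow> 0 + c"
    by (intro tendsto_add compact_op_diagonal K tendsto_const)
  then show ?thesis
    by (simp add: plus_blinfun.rep_eq scalar_op.rep_eq cinner_add_right cinner_cscale_right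
        cinner_unit_vec coord_unit_vec)
qed

lemma scalar_part_eq: "compact_op K \<Longrightarrow> scalar_part (K + scalar_op c) = c"
  unfolding scalar_part_def by (rule limI) (rule scalar_part_diagonal)

lemma scalar_part_compact: "compact_op K \<Longrightarrow> scalar_part K = 0"
  using scalar_part_eq[of K 0] by (simp add: scalar_op_0)

lemma scalar_part_scalar: "scalar_part (scalar_op c) = c"
  using scalar_part_eq[OF compact_op_0] by simp

lemma scalar_part_add:
  assumes "a \<in> compact_plus_scalars" "b \<in> compact_plus_scalars"
  shows "scalar_part (a + b) = scalar_part a + scalar_part b"
proof -
  obtain K c L d where ab: "a = K + scalar_op c" "b = L + scalar_op d"
    and KL: "compact_op K" "compact_op L"
    using assms by (metis cpsE)
  have eq: "a + b = (K + L) + scalar_op (c + d)" by (simp add: ab scalar_op_add)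
  have "scalar_part (a + b) = c + d"
    unfolding eq by (intro scalar_part_eq compact_op_add KL)
  moreover have "scalar_part a = c" "scalar_part b = d"
    unfolding ab by (intro scalar_part_eq KL)+
  ultimately show ?thesis by simp
qed

lemma scalar_part_comp:
  assumes "a \<in> compact_plus_scalars" "b \<in> compact_plus_scalars"
  shows "scalar_part (a o\<^sub>L b) = scalar_part a * scalar_part b"
proof -
  obtain K c L d where ab: "a = K + scalar_op c" "b = L + scalar_op d"
    and KL: "compact_op K" "compact_op L"
    using assms by (metis cpsE)
  have "a o\<^sub>L b = ((K o\<^sub>L b) + (scalar_op c o\<^sub>L L)) + scalar_op (c * d)"
    unfolding scalar_op_mult[symmetric] ab
    by (rule blinfun_eqI) (simp add: plus_blinfun.rep_eq blinfun.add_right)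
  moreover have "compact_op ((K o\<^sub>L b) + (scalar_op c o\<^sub>L L))"
    using KL cps_clinear[OF assms(2)]
    by (intro compact_op_add compact_op_comp_left compact_op_comp_right clinear_scalar_op)
  ultimately show ?thesis using KL by (simp add: ab scalar_part_eq)
qed

lemma cps_adj_scalar_part:
  assumes "a \<in> compact_plus_scalars"
  shows "adj a \<in> compact_plus_scalars \<and> scalar_part (adj a) = cnj (scalar_part a)"
proof -
  obtain K c where a: "a = K + scalar_op c" and K: "compact_op K"
    using assms by (metis cpsE)
  have "adj a = adj K + scalar_op (cnj c)"
    using K by (simp add: a adj_add adj_scalar_op clinear_scalar_op compact_op_def)
  then show ?thesis using K by (simp add: a scalar_part_eq compact_op_adj cpsI)
qed

lemma norm_scalar_part_le:
  assumes "a \<in> compact_plus_scalars"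
  shows "cmod (scalar_part a) \<le> norm a"
proof -
  obtain K c where a: "a = K + scalar_op c" and K: "compact_op K"
    using assms by (metis cpsE)
  have bd: "cmod (cinner (unit_vec n) (a (unit_vec n))) \<le> norm a" for n
    using cinner_Cauchy_Schwarz[of "unit_vec n" "a (unit_vec n)"] norm_blinfun[of a "unit_vec n"]
    by (simp add: norm_unit_vec)
  show ?thesis
    unfolding a scalar_part_eq[OF K]
    by (rule Lim_bounded[OF tendsto_norm[OF scalar_part_diagonal[OF K]], of 0])
      (use bd in \<open>simp add: a\<close>)
qed

lemma scalar_part_diff:
  assumes "a \<in> compact_plus_scalars" "b \<in> compact_plus_scalars"
  shows "a - b \<in> compact_plus_scalars" "scalar_part (a - b) = scalar_part a - scalar_part b"
proof -
  have m: "scalar_op (- 1) o\<^sub>L b \<in> compact_plus_scalars"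
    by (intro cps_comp scalar_in_cps assms)
  show "a - b \<in> compact_plus_scalars"
    using cps_add[OF assms(1) m] by (simp add: scalar_op_minus_1)
  show "scalar_part (a - b) = scalar_part a - scalar_part b"
    using scalar_part_add[OF assms(1) m] scalar_part_comp[OF scalar_in_cps assms(2), of "- 1"]
    by (simp add: scalar_op_minus_1 scalar_part_scalar)
qed

lemma norm_scalar_op_le: "norm (scalar_op c) \<le> cmod c"
  by (rule norm_blinfun_bound) (simp_all add: scalar_op.rep_eq norm_cscale)

text \<open>The scalar parts of a convergent sequence converge because the character is contractive;
  subtracting them leaves a convergent sequence of compact operators.\<close>

lemma cps_limit:
  assumes a: "\<And>n. a n \<in> compact_plus_scalars" and lim: "a \<longlonglongrightarrow> b"
  shows "b \<in> compact_plus_scalars" "(\<lambda>n. scalar_part (a n)) \<longlonglongrightarrow> scalar_part b"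
proof -
  have "Cauchy (\<lambda>n. scalar_part (a n))"
  proof (rule metric_CauchyI)
    fix e :: real assume "e > 0"
    then obtain N where N: "\<And>m n. m \<ge> N \<Longrightarrow> n \<ge> N \<Longrightarrow> dist (a m) (a n) < e"
      using LIMSEQ_imp_Cauchy[OF lim] unfolding Cauchy_def by blast
    have "dist (scalar_part (a m)) (scalar_part (a n)) \<le> dist (a m) (a n)" for m n
      unfolding dist_norm scalar_part_diff(2)[OF a a, symmetric]
      by (intro norm_scalar_part_le scalar_part_diff a)
    then show "\<exists>N. \<forall>m\<ge>N. \<forall>n\<ge>N. dist (scalar_part (a m)) (scalar_part (a n)) < e"
      using N by (meson le_less_trans)
  qed
  then obtain c where c: "(\<lambda>n. scalar_part (a n)) \<longlonglongrightarrow> c"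
    using Cauchy_convergent convergent_def by blast
  have "compact_op (b - scalar_op c)"
  proof (rule compact_op_limit)
    show "compact_op (a n - scalar_op (scalar_part (a n)))" for n
      by (rule cpsE[OF a[of n]]) (simp add: scalar_part_eq)
    have "(\<lambda>n. scalar_op (scalar_part (a n)) - scalar_op c) \<longlonglongrightarrow> 0"
    proof (rule Lim_null_comparison)
      have "scalar_op (scalar_part (a n)) - scalar_op c = scalar_op (scalar_part (a n) - c)" for n
        using scalar_op_add[of "scalar_part (a n) - c" c] by simp
      then show "\<forall>\<^sub>F n in sequentially.
          norm (scalar_op (scalar_part (a n)) - scalar_op c) \<le> cmod (scalar_part (a n) - c)"
        by (simp add: norm_scalar_op_le)
      show "(\<lambda>n. cmod (scalar_part (a n) - c)) \<longlonglongrightarrow> 0"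
        by (intro tendsto_norm_zero LIM_zero c)
    qed
    then show "(\<lambda>n. a n - scalar_op (scalar_part (a n))) \<longlonglongrightarrow> b - scalar_op c"
      by (intro tendsto_diff lim) (rule LIM_zero_cancel)
  qed
  from cpsI[OF this, of c] scalar_part_eq[OF this, of c] c
  show "b \<in> compact_plus_scalars" "(\<lambda>n. scalar_part (a n)) \<longlonglongrightarrow> scalar_part b" by simp_all
qed


section \<open>Isometries along the branches of the binary tree\<close>

text \<open>A subset \<open>t\<close> of the natural numbers is an infinite path in the binary tree, and \<open>branch t n\<close> is
  an injective code of its node at depth \<open>n\<close>. The code contains the depth because paths are to meet
  only at equal depths: distinct paths then share exactly the nodes above the point where they
  separate.\<close>

definition branch :: "nat set \<Rightarrow> nat \<Rightarrow> nat" where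
  "branch t n = prod_encode (n, set_encode (t \<inter> {..<n}))"

lemma branch_eq_iff: "branch s m = branch t n \<longleftrightarrow> m = n \<and> s \<inter> {..<n} = t \<inter> {..<n}"
proof -
  have "set_encode (s \<inter> {..<n}) = set_encode (t \<inter> {..<n}) \<longleftrightarrow> s \<inter> {..<n} = t \<inter> {..<n}"
    by (intro set_encode_eq) auto
  then show ?thesis unfolding branch_def prod_encode_eq by auto
qed

lemma inj_branch: "inj (branch t)"
  by (rule injI) (simp add: branch_eq_iff)

lift_definition pullback_vec :: "nat set \<Rightarrow> l2 \<Rightarrow> l2" is "\<lambda>t x n. x (branch t n)"
  subgoal for t x using summable_reindex[OF _ inj_branch, of "\<lambda>n. (cmod (x n))\<^sup>2" t] by (simp add: o_def)
  done

lift_definition pullback :: "nat set \<Rightarrow> (l2 \<Rightarrow>\<^sub>L l2)" is pullback_vec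
proof (rule bounded_linear_intro)
  fix t :: "nat set"
  show "pullback_vec t (x + y) = pullback_vec t x + pullback_vec t y" for x y
    by transfer simp
  show "pullback_vec t (r *\<^sub>R x) = r *\<^sub>R pullback_vec t x" for r x
    by transfer simp
  show "norm (pullback_vec t x) \<le> norm x * 1" for x
  proof -
    have "(\<Sum>n. (cmod (coord (pullback_vec t x) n))\<^sup>2) \<le> (\<Sum>n. (cmod (coord x n))\<^sup>2)"
      using suminf_reindex_mono[OF sums_summable[OF norm_l2_sums[of x]] inj_branch[of t]]
      by (simp add: o_def pullback_vec.rep_eq)
    then have "(norm (pullback_vec t x))\<^sup>2 \<le> (norm x)\<^sup>2"
      by (simp add: sums_unique[OF norm_l2_sums, symmetric])
    then have "norm (pullback_vec t x) \<le> norm x" by (rule power2_le_imp_le) simp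
    then show ?thesis by simp
  qed
qed

lemma coord_pullback: "coord (pullback t x) n = coord x (branch t n)"
  by (simp add: pullback.rep_eq pullback_vec.rep_eq)

lemma clinear_pullback: "clinear_op (pullback t)"
  unfolding clinear_op_def coord_inject[symmetric] fun_eq_iff cscale.rep_eq coord_pullback by simp

text \<open>The isometry that sends the \<open>n\<close>-th unit vector to the unit vector at the node \<open>branch t n\<close>.
  Defining it as an adjoint of a pullback of sequences spares a case distinction on the range of the
  path.\<close>

definition branch_isometry :: "nat set \<Rightarrow> (l2 \<Rightarrow>\<^sub>L l2)" where
  "branch_isometry t = adj (pullback t)"

lemma clinear_branch_isometry: "clinear_op (branch_isometry t)"
  by (simp add: branch_isometry_def clinear_adj clinear_pullback)

lemma adj_branch_isometry: "adj (branch_isometry t) = pullback t"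
  by (simp add: branch_isometry_def adj_adj clinear_pullback)

text \<open>Going down the path \<open>t\<close> and reading off along \<open>s\<close> recovers precisely the coordinates at the
  common nodes. Hence the product is the identity for \<open>s = t\<close> and a coordinate projection of finite
  rank otherwise.\<close>

lemma coord_branch_product:
  "coord ((adj (branch_isometry s) o\<^sub>L branch_isometry t) x) n =
    (if s \<inter> {..<n} = t \<inter> {..<n} then coord x n else 0)"
proof -
  let ?m = "branch s n"
  have "coord ((adj (branch_isometry s) o\<^sub>L branch_isometry t) x) n = coord (branch_isometry t x) ?m"
    unfolding adj_branch_isometry blinfun_apply_blinfun_compose coord_pullback ..
  also have "\<dots> = cinner (pullback t (unit_vec ?m)) x"
    unfolding cinner_unit_vec[symmetric] branch_isometry_def by (rule cinner_adj_right[OF clinear_pullback])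
  also have "pullback t (unit_vec ?m) = (if s \<inter> {..<n} = t \<inter> {..<n} then unit_vec n else 0)"
    unfolding coord_inject[symmetric] fun_eq_iff coord_pullback coord_unit_vec branch_eq_iff
    by (auto simp: coord_unit_vec zero_l2.rep_eq)
  also have "cinner \<dots> x = (if s \<inter> {..<n} = t \<inter> {..<n} then coord x n else 0)"
    by (simp add: cinner_unit_vec) (simp add: cinner_def zero_l2.rep_eq)
  finally show ?thesis .
qed

lemma branch_product_same: "adj (branch_isometry t) o\<^sub>L branch_isometry t = scalar_op 1"
proof (rule blinfun_eqI)
  show "(adj (branch_isometry t) o\<^sub>L branch_isometry t) x = scalar_op 1 x" for x
    unfolding coord_inject[symmetric] fun_eq_iff coord_branch_product
    by (simp add: scalar_op.rep_eq cscale_1)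
qed

lemma branch_product_distinct:
  assumes "s \<noteq> t"
  shows "compact_op (adj (branch_isometry s) o\<^sub>L branch_isometry t)"
proof -
  let ?P = "adj (branch_isometry s) o\<^sub>L branch_isometry t"
  obtain i where i: "(i \<in> s) \<noteq> (i \<in> t)" using assms by (auto simp: set_eq_iff)
  have "proj (Suc i) (?P x) = ?P x" for x
  proof (rule coord_inject[THEN iffD1], rule ext)
    fix n
    show "coord (proj (Suc i) (?P x)) n = coord (?P x) n"
    proof (cases "n < Suc i")
      case True
      then show ?thesis unfolding coord_proj by simp
    next
      case False
      then have "i \<in> {..<n}" by simp
      then have "s \<inter> {..<n} \<noteq> t \<inter> {..<n}" using i by blast
      then show ?thesis using False unfolding coord_proj coord_branch_product by simp
    qed
  qed
  then have eq: "proj (Suc i) o\<^sub>L ?P = ?P"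
    by (intro blinfun_eqI) (simp only: blinfun_apply_blinfun_compose[of "proj (Suc i)"])
  have "clinear_op ?P" by (intro clinear_op_comp clinear_adj clinear_branch_isometry)
  from compact_op_comp_right[OF compact_op_proj this, of "Suc i"] show ?thesis
    unfolding eq .
qed


section \<open>The module generated by the branch isometries\<close>

lemma blinfun_compose_assoc: "(S o\<^sub>L T) o\<^sub>L U = S o\<^sub>L (T o\<^sub>L U)"
  by (rule blinfun_eqI) simp

lemma blinfun_compose_add_left: "(S + T) o\<^sub>L U = (S o\<^sub>L U) + (T o\<^sub>L U)"
  by (rule blinfun_eqI) (simp add: plus_blinfun.rep_eq)

lemma blinfun_compose_add_right: "U o\<^sub>L (S + T) = (U o\<^sub>L S) + (U o\<^sub>L T)"
  by (rule blinfun_eqI) (simp add: plus_blinfun.rep_eq blinfun.add_right)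

text \<open>The sum of the compact operators and the complex span of the branch isometries. Starting from
  all compact operators makes this set stable under the right action, since a branch isometry times
  a compact operator is compact.\<close>

inductive_set branch_span :: "(l2 \<Rightarrow>\<^sub>L l2) set" where
  compact: "compact_op K \<Longrightarrow> K \<in> branch_span"
| step: "x \<in> branch_span \<Longrightarrow> x + (scalar_op c o\<^sub>L branch_isometry t) \<in> branch_span"

lemma clinear_branch_span: "x \<in> branch_span \<Longrightarrow> clinear_op x"
  by (induction rule: branch_span.induct)
    (auto simp: compact_op_def intro: clinear_op_add clinear_op_comp clinear_scalar_op clinear_branch_isometry)

lemma branch_span_add_compact: "y \<in> branch_span \<Longrightarrow> compact_op K \<Longrightarrow> y + K \<in> branch_span"
proof (induction rule: branch_span.induct)
  case (compact L)
  then show ?case by (intro branch_span.compact compact_op_add)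
next
  case (step x c t)
  then show ?case using branch_span.step[of "x + K" c t] by (simp add: add_ac)
qed

lemma branch_span_add: "y \<in> branch_span \<Longrightarrow> x \<in> branch_span \<Longrightarrow> x + y \<in> branch_span"
proof (induction rule: branch_span.induct)
  case (compact K)
  then show ?case by (intro branch_span_add_compact)
next
  case (step y c t)
  then show ?case using branch_span.step[of "x + y" c t] by (simp add: add_ac)
qed

lemma branch_span_act:
  assumes "x \<in> branch_span" "a \<in> compact_plus_scalars"
  shows "x o\<^sub>L a \<in> branch_span"
  using assms(1)
proof (induction rule: branch_span.induct)
  case (compact K)
  then show ?case using assms(2) by (intro branch_span.compact compact_op_comp_right cps_clinear)
next
  case (step x c t)
  let ?V = "branch_isometry t"
  obtain L d where L: "compact_op L" and a: "a = L + scalar_op d" using assms(2) by (rule cpsE)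
  have V: "?V o\<^sub>L scalar_op d = scalar_op d o\<^sub>L ?V"
    by (rule scalar_op_comp_commute[OF clinear_branch_isometry])
  have "(x + (scalar_op c o\<^sub>L ?V)) o\<^sub>L a =
      ((x o\<^sub>L a) + ((scalar_op c o\<^sub>L ?V) o\<^sub>L L)) + (scalar_op (c * d) o\<^sub>L ?V)"
    unfolding blinfun_compose_add_left scalar_op_mult[symmetric] blinfun_compose_assoc V[symmetric]
    by (subst (2) a) (simp add: blinfun_compose_add_right blinfun_compose_assoc add_ac)
  then show ?case
    using step.IH L by (auto intro!: branch_span.step branch_span_add_compact compact_op_comp_left
        clinear_op_comp clinear_scalar_op clinear_branch_isometry)
qed

lemma branch_coefficient:
  assumes "y \<in> branch_span"
  shows "adj (branch_isometry t) o\<^sub>L y \<in> compact_plus_scalars"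
  using assms
proof (induction rule: branch_span.induct)
  case (compact K)
  then show ?case
    by (intro compact_in_cps compact_op_comp_left clinear_adj clinear_branch_isometry)
next
  case (step x c s)
  have "adj (branch_isometry t) o\<^sub>L branch_isometry s \<in> compact_plus_scalars"
    by (cases "t = s") (auto simp: branch_product_same scalar_in_cps
        intro: compact_in_cps branch_product_distinct)
  then have "scalar_op c o\<^sub>L (adj (branch_isometry t) o\<^sub>L branch_isometry s) \<in> compact_plus_scalars"
    by (rule cps_comp[OF scalar_in_cps])
  also have "scalar_op c o\<^sub>L (adj (branch_isometry t) o\<^sub>L branch_isometry s) =
      adj (branch_isometry t) o\<^sub>L (scalar_op c o\<^sub>L branch_isometry s)"
    unfolding blinfun_compose_assoc[symmetric]
      scalar_op_comp_commute[OF clinear_adj[OF clinear_branch_isometry]] ..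
  finally show ?case using step.IH by (simp add: blinfun_compose_add_right cps_add)
qed

lemma branch_span_inner:
  assumes "x \<in> branch_span" "y \<in> branch_span"
  shows "adj x o\<^sub>L y \<in> compact_plus_scalars"
  using assms(1)
proof (induction rule: branch_span.induct)
  case (compact K)
  then show ?case
    by (intro compact_in_cps compact_op_comp_right compact_op_adj clinear_branch_span assms(2))
next
  case (step x c t)
  have "adj (x + (scalar_op c o\<^sub>L branch_isometry t)) =
      adj x + (scalar_op (cnj c) o\<^sub>L adj (branch_isometry t))"
    using scalar_op_comp_commute[OF clinear_adj[OF clinear_branch_isometry]]
    by (simp add: adj_add adj_comp adj_scalar_op clinear_branch_span[OF step.hyps] clinear_op_comp
        clinear_scalar_op clinear_branch_isometry)
  then show ?case
    using step.IH branch_coefficient[OF assms(2), of t]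
    by (simp add: blinfun_compose_add_left blinfun_compose_assoc cps_add cps_comp scalar_in_cps)
qed

text \<open>Modulo compact operators the branch isometries are orthonormal, so only the finitely many that
  occur in an element of the span have a nonzero coefficient.\<close>

lemma finite_branch_coefficients:
  assumes "x \<in> branch_span"
  shows "finite {t. scalar_part (adj (branch_isometry t) o\<^sub>L x) \<noteq> 0}"
  using assms
proof (induction rule: branch_span.induct)
  case (compact K)
  then have "scalar_part (adj (branch_isometry t) o\<^sub>L K) = 0" for t
    by (intro scalar_part_compact compact_op_comp_left clinear_adj clinear_branch_isometry)
  then show ?case by simp
next
  case (step x c s)
  have "scalar_part (adj (branch_isometry t) o\<^sub>L (x + (scalar_op c o\<^sub>L branch_isometry s))) =
      scalar_part (adj (branch_isometry t) o\<^sub>L x)" if "t \<noteq> s" for t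
  proof -
    have K: "compact_op (adj (branch_isometry t) o\<^sub>L (scalar_op c o\<^sub>L branch_isometry s))"
      unfolding blinfun_compose_assoc[symmetric]
        scalar_op_comp_commute[OF clinear_adj[OF clinear_branch_isometry]]
      using that unfolding blinfun_compose_assoc
      by (intro compact_op_comp_left clinear_scalar_op branch_product_distinct)
    show ?thesis
      unfolding blinfun_compose_add_right
      by (subst scalar_part_add)
        (simp_all add: branch_coefficient step.hyps compact_in_cps[OF K] scalar_part_compact[OF K])
  qed
  note eq = this
  have "{t. scalar_part (adj (branch_isometry t) o\<^sub>L (x + (scalar_op c o\<^sub>L branch_isometry s))) \<noteq> 0}
      \<subseteq> insert s {t. scalar_part (adj (branch_isometry t) o\<^sub>L x) \<noteq> 0}"
    (is "?L \<subseteq> ?R")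
  proof
    fix t assume t: "t \<in> ?L"
    show "t \<in> ?R"
    proof (cases "t = s")
      case False
      then show ?thesis using t unfolding mem_Collect_eq eq[OF False] by (intro insertI2 CollectI)
    qed simp
  qed
  then show ?case by (rule finite_subset) (simp add: step.IH)
qed

text \<open>The inner product is that of the algebra of all bounded operators regarded as a right module over
  itself; on this submodule its values are compact plus scalar.\<close>

definition branch_module :: "(l2 \<Rightarrow>\<^sub>L l2) hilbert_structure" where
  "branch_module = \<lparr>hcarrier = closure branch_span, hadd = (+), hzero = 0,
     hscale = (\<lambda>c x. scalar_op c o\<^sub>L x), hact = (o\<^sub>L), hinner = (\<lambda>x y. adj x o\<^sub>L y)\<rparr>"

lemma clinear_branch_module:
  assumes "x \<in> closure branch_span"
  shows "clinear_op x"
proof -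
  obtain u where "\<forall>n. u n \<in> branch_span" and u_lim: "u \<longlonglongrightarrow> x"
    using assms unfolding closure_sequential by auto
  note u = spec[OF this(1)] u_lim
  show ?thesis by (rule clinear_op_limit[OF clinear_branch_span[OF u(1)] u(2)])
qed

lemma branch_module_inner:
  assumes "x \<in> closure branch_span" "y \<in> closure branch_span"
  shows "adj x o\<^sub>L y \<in> compact_plus_scalars"
proof -
  obtain u where "\<forall>n. u n \<in> branch_span" and u_lim: "u \<longlonglongrightarrow> x"
    using assms(1) unfolding closure_sequential by auto
  note u = spec[OF this(1)] u_lim
  obtain v where "\<forall>n. v n \<in> branch_span" and v_lim: "v \<longlonglongrightarrow> y"
    using assms(2) unfolding closure_sequential by auto
  note v = spec[OF this(1)] v_lim
  show ?thesis
  proof (rule cps_limit)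
    show "adj (u n) o\<^sub>L v n \<in> compact_plus_scalars" for n
      by (intro branch_span_inner u v)
    show "(\<lambda>n. adj (u n) o\<^sub>L v n) \<longlonglongrightarrow> (adj x o\<^sub>L y)"
      by (intro tendsto_blinfun_compose tendsto_adj v clinear_branch_span
          clinear_branch_module assms u)
  qed
qed

lemma branch_module_add:
  assumes "x \<in> closure branch_span" "y \<in> closure branch_span"
  shows "x + y \<in> closure branch_span"
proof -
  obtain u where "\<forall>n. u n \<in> branch_span" and u_lim: "u \<longlonglongrightarrow> x"
    using assms(1) unfolding closure_sequential by auto
  note u = spec[OF this(1)] u_lim
  obtain v where "\<forall>n. v n \<in> branch_span" and v_lim: "v \<longlonglongrightarrow> y"
    using assms(2) unfolding closure_sequential by auto
  note v = spec[OF this(1)] v_lim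
  have "\<forall>n. u n + v n \<in> branch_span" using u v by (simp add: branch_span_add)
  then show ?thesis
    unfolding closure_sequential using tendsto_add[OF u(2) v(2)] by (intro exI[of _ "\<lambda>n. u n + v n"] conjI)
qed

lemma branch_module_act:
  assumes "x \<in> closure branch_span" "a \<in> compact_plus_scalars"
  shows "x o\<^sub>L a \<in> closure branch_span"
proof -
  obtain u where "\<forall>n. u n \<in> branch_span" and u_lim: "u \<longlonglongrightarrow> x"
    using assms(1) unfolding closure_sequential by auto
  note u = spec[OF this(1)] u_lim
  have "\<forall>n. u n o\<^sub>L a \<in> branch_span" using u assms(2) by (simp add: branch_span_act)
  then show ?thesis
    unfolding closure_sequential
    using tendsto_blinfun_compose[OF u(2) tendsto_const[of a]] by (intro exI[of _ "\<lambda>n. u n o\<^sub>L a"] conjI)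
qed

lemma branch_module_scale:
  assumes "x \<in> closure branch_span"
  shows "scalar_op c o\<^sub>L x \<in> closure branch_span"
  unfolding scalar_op_comp_commute[OF clinear_branch_module[OF assms], symmetric]
  by (intro branch_module_act assms scalar_in_cps)

lemma branch_isometry_in_module: "branch_isometry t \<in> closure branch_span"
  using subsetD[OF closure_subset branch_span.step[OF branch_span.compact[OF compact_op_0], of 1 t]]
  by (simp add: scalar_op_1)

lemma hdist_branch_module:
  assumes "x \<in> closure branch_span" "y \<in> closure branch_span"
  shows "hdist branch_module x y = norm (x - y)"
proof -
  have "clinear_op (x - y)" using assms by (intro clinear_op_diff clinear_branch_module)
  then show ?thesis
    by (simp add: hdist_def hnorm_def branch_module_def scalar_op_minus_1 cstar_identity)
qed

lemma hilbert_module_branch_module: "hilbert_module compact_plus_scalars branch_module"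
proof
  note sel = branch_module_def
  let ?M = branch_module
  fix x y z :: "l2 \<Rightarrow>\<^sub>L l2" and a b :: "l2 \<Rightarrow>\<^sub>L l2" and c d :: complex
  assume "x \<in> hcarrier ?M"
  then have x: "x \<in> closure branch_span" by (simp add: sel)
  show "hscale ?M c x \<in> hcarrier ?M" using x by (simp add: sel branch_module_scale)
  show "hadd ?M (hzero ?M) x = x" by (simp add: sel)
  show "hadd ?M x (hscale ?M (- 1) x) = hzero ?M" by (simp add: sel scalar_op_minus_1)
  show "hscale ?M (c + d) x = hadd ?M (hscale ?M c x) (hscale ?M d x)"
    by (simp add: sel scalar_op_add blinfun_compose_add_left)
  show "hscale ?M c (hscale ?M d x) = hscale ?M (c * d) x"
    by (simp add: sel blinfun_compose_assoc[symmetric] scalar_op_mult)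
  show "hscale ?M 1 x = x" by (simp add: sel scalar_op_1)
  show "positive_op (hinner ?M x x)"
    using clinear_branch_module[OF x]
    by (simp add: sel positive_op_def clinear_op_comp clinear_adj cinner_adj_right cinner_self)
  show "hinner ?M x x = 0 \<Longrightarrow> x = hzero ?M"
    using cstar_identity[OF clinear_branch_module[OF x]] by (simp add: sel)
  show "a \<in> compact_plus_scalars \<Longrightarrow> hact ?M x a \<in> hcarrier ?M"
    using x by (simp add: sel branch_module_act)
  show "hact ?M x (a + b) = hadd ?M (hact ?M x a) (hact ?M x b)"
    by (simp add: sel blinfun_compose_add_right)
  show "hact ?M (hact ?M x a) b = hact ?M x (a o\<^sub>L b)"
    by (simp add: sel blinfun_compose_assoc)
  show "hact ?M (hscale ?M c x) a = hscale ?M c (hact ?M x a)"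
    by (simp add: sel blinfun_compose_assoc)
  show "hact ?M x (scalar_op c o\<^sub>L a) = hscale ?M c (hact ?M x a)"
    using scalar_op_comp_commute[OF clinear_branch_module[OF x], of c]
    by (simp add: sel blinfun_compose_assoc[symmetric])
  assume "y \<in> hcarrier ?M"
  then have y: "y \<in> closure branch_span" by (simp add: sel)
  show "hadd ?M x y \<in> hcarrier ?M" using x y by (simp add: sel branch_module_add)
  show "hinner ?M x y \<in> compact_plus_scalars" using x y by (simp add: sel branch_module_inner)
  show "hadd ?M x y = hadd ?M y x" by (simp add: sel)
  show "hscale ?M c (hadd ?M x y) = hadd ?M (hscale ?M c x) (hscale ?M c y)"
    by (simp add: sel blinfun_compose_add_right)
  show "hact ?M (hadd ?M x y) a = hadd ?M (hact ?M x a) (hact ?M y a)"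
    by (simp add: sel blinfun_compose_add_left)
  show "hinner ?M x (hscale ?M c y) = scalar_op c o\<^sub>L hinner ?M x y"
    using scalar_op_comp_commute[OF clinear_adj[OF clinear_branch_module[OF x]], of c]
    by (simp add: sel blinfun_compose_assoc[symmetric])
  show "hinner ?M x (hact ?M y a) = hinner ?M x y o\<^sub>L a"
    by (simp add: sel blinfun_compose_assoc)
  show "hinner ?M y x = adj (hinner ?M x y)"
    using clinear_branch_module[OF x] clinear_branch_module[OF y]
    by (simp add: sel adj_comp adj_adj clinear_adj)
  assume "z \<in> hcarrier ?M"
  show "hadd ?M (hadd ?M x y) z = hadd ?M x (hadd ?M y z)" by (simp add: sel add.assoc)
  show "hinner ?M x (hadd ?M y z) = hinner ?M x y + hinner ?M x z"
    by (simp add: sel blinfun_compose_add_right)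
next
  show "hzero branch_module \<in> hcarrier branch_module"
    using subsetD[OF closure_subset branch_span.compact[OF compact_op_0]]
    by (simp add: branch_module_def)
next
  fix u :: "nat \<Rightarrow> l2 \<Rightarrow>\<^sub>L l2"
  assume "\<And>n. u n \<in> hcarrier branch_module"
  then have u: "u n \<in> closure branch_span" for n by (simp add: branch_module_def)
  assume "\<And>e. e > 0 \<Longrightarrow> \<exists>N. \<forall>m\<ge>N. \<forall>n\<ge>N. hdist branch_module (u m) (u n) < e"
  then have "Cauchy u"
    unfolding hdist_branch_module[OF u u] by (intro metric_CauchyI) (simp add: dist_norm)
  from Cauchy_convergent[OF this] obtain x where lim: "u \<longlonglongrightarrow> x"
    unfolding convergent_def by (rule exE)
  have x: "x \<in> closure branch_span"
    by (rule closed_sequentially[OF closed_closure u lim])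
  have "(\<lambda>n. hdist branch_module (u n) x) \<longlonglongrightarrow> 0"
    unfolding hdist_branch_module[OF u x] by (intro tendsto_norm_zero LIM_zero lim)
  then show "\<exists>x\<in>hcarrier branch_module. (\<lambda>n. hdist branch_module (u n) x) \<longlonglongrightarrow> 0"
    using x by (intro bexI[of _ x]) (simp_all add: branch_module_def)
qed

text \<open>Each element is a limit of a sequence in the span, and each member of that sequence meets only
  finitely many branches.\<close>

lemma countable_branch_coefficients:
  assumes "x \<in> closure branch_span"
  shows "countable {t. scalar_part (adj (branch_isometry t) o\<^sub>L x) \<noteq> 0}"
proof -
  obtain u where "\<forall>n. u n \<in> branch_span" and u_lim: "u \<longlonglongrightarrow> x"
    using assms unfolding closure_sequential by auto
  note u = spec[OF this(1)] u_lim
  let ?N = "\<Union>n. {t. scalar_part (adj (branch_isometry t) o\<^sub>L u n) \<noteq> 0}"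
  have "scalar_part (adj (branch_isometry t) o\<^sub>L x) = 0" if "t \<notin> ?N" for t
  proof (rule LIMSEQ_unique)
    show "(\<lambda>n. scalar_part (adj (branch_isometry t) o\<^sub>L u n)) \<longlonglongrightarrow>
        scalar_part (adj (branch_isometry t) o\<^sub>L x)"
      by (rule cps_limit(2)) (intro branch_coefficient tendsto_blinfun_compose tendsto_const u)+
    show "(\<lambda>n. scalar_part (adj (branch_isometry t) o\<^sub>L u n)) \<longlonglongrightarrow> 0" using that by simp
  qed
  then have "{t. scalar_part (adj (branch_isometry t) o\<^sub>L x) \<noteq> 0} \<subseteq> ?N" by blast
  moreover have "countable ?N"
    by (rule countable_UN[OF countableI_type countable_finite[OF finite_branch_coefficients[OF u(1)]]])
  ultimately show ?thesis by (rule countable_subset)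
qed


section \<open>The character as a state of the bidual\<close>

definition character :: op_functional where
  "character = cutoff compact_plus_scalars scalar_part"

lemma character_apply: "a \<in> compact_plus_scalars \<Longrightarrow> character a = scalar_part a"
  by (simp add: character_def cutoff_def)

lemma character_in_dual: "character \<in> dual compact_plus_scalars"
proof -
  have "cmod (character a) \<le> 1 * norm a" if "a \<in> compact_plus_scalars" for a
    using norm_scalar_part_le[OF that] by (simp add: character_apply that)
  moreover have "character a = 0" if "a \<notin> compact_plus_scalars" for a
    using that by (simp add: character_def cutoff_def)
  ultimately show ?thesis
    unfolding dual_def mem_Collect_eq
    by (intro conjI ballI allI impI exI[of _ 1])
      (simp_all add: character_apply cps_add cps_comp scalar_in_cps scalar_part_add
        scalar_part_comp scalar_part_scalar)
qed

lemma dual_scale: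
  assumes "\<phi> \<in> dual A"
  shows "(\<lambda>a. c * \<phi> a) \<in> dual A"
proof -
  obtain B where B: "\<forall>a\<in>A. cmod (\<phi> a) \<le> B * norm a"
    using assms unfolding dual_def by auto
  have "cmod (c * \<phi> a) \<le> (cmod c * B) * norm a" if "a \<in> A" for a
    using mult_left_mono[OF bspec[OF B that], of "cmod c"] by (simp add: norm_mult mult.assoc)
  then show ?thesis
    using assms unfolding dual_def mem_Collect_eq
    by (intro conjI ballI allI impI exI[of _ "cmod c * B"]) (simp_all add: distrib_left)
qed

text \<open>Multiplicativity of the character collapses the Arens product, and compatibility with adjoints
  identifies the value of \<open>R\<^sup>*\<close> with the conjugate of that of \<open>R\<close>.\<close>

lemma character_Arens_square:
  assumes R: "R \<in> bidual compact_plus_scalars"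
  shows "bidual_mult compact_plus_scalars (bidual_star compact_plus_scalars R) R character =
    complex_of_real ((cmod (R character))\<^sup>2)"
proof -
  let ?A = compact_plus_scalars
  let ?r = "R character"
  have R_scale: "R (\<lambda>a. c * character a) = c * ?r" for c
    using R character_in_dual unfolding bidual_def by blast
  have "cutoff ?A (\<lambda>b. character (a o\<^sub>L b)) = (\<lambda>b. scalar_part a * character b)" if "a \<in> ?A" for a
  proof
    show "cutoff ?A (\<lambda>b. character (a o\<^sub>L b)) b = scalar_part a * character b" for b
      by (cases "b \<in> ?A")
        (simp_all add: that cutoff_def character_def cps_comp scalar_part_comp)
  qed
  then have inner: "cutoff ?A (\<lambda>a. R (cutoff ?A (\<lambda>b. character (a o\<^sub>L b)))) = (\<lambda>a. ?r * character a)"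
  proof (intro ext)
    fix a
    assume *: "\<And>a. a \<in> ?A \<Longrightarrow>
      cutoff ?A (\<lambda>b. character (a o\<^sub>L b)) = (\<lambda>b. scalar_part a * character b)"
    show "cutoff ?A (\<lambda>a. R (cutoff ?A (\<lambda>b. character (a o\<^sub>L b)))) a = ?r * character a"
    proof (cases "a \<in> ?A")
      case True
      then show ?thesis
        unfolding cutoff_def[of _ "\<lambda>a. R (cutoff _ (_ a))"] *[OF True] R_scale
        by (simp add: character_apply)
    qed (simp add: cutoff_def character_def)
  qed
  have star: "cutoff ?A (\<lambda>a. cnj (?r * character (adj a))) = (\<lambda>a. cnj ?r * character a)"
  proof
    show "cutoff ?A (\<lambda>a. cnj (?r * character (adj a))) a = cnj ?r * character a" for a
      using cps_adj_scalar_part[of a] by (cases "a \<in> ?A") (simp_all add: cutoff_def character_def)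
  qed
  have "bidual_mult ?A (bidual_star ?A R) R character = bidual_star ?A R (\<lambda>a. ?r * character a)"
    unfolding bidual_mult_def cutoff_def[of "dual ?A"] inner by (simp add: character_in_dual)
  also have "\<dots> = cnj (R (\<lambda>a. cnj ?r * character a))"
    unfolding bidual_star_def cutoff_def[of "dual ?A"] star
    by (simp add: dual_scale character_in_dual)
  also have "\<dots> = ?r * cnj ?r"
    unfolding R_scale by simp
  also have "\<dots> = complex_of_real ((cmod ?r)\<^sup>2)"
    by (simp only: complex_norm_square)
  finally show ?thesis .
qed


section \<open>Absence of frames\<close>

text \<open>The vector state at \<open>v\<close> turns the frame sum for \<open>y\<close> into the sum of the numbers
  \<open>\<parallel>x\<^sub>j\<^sup>* y v\<parallel>\<^sup>2\<close>, and a convergent sum of complex numbers has countable support.\<close>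

lemma ultraweak_sum_countable:
  assumes S: "ultraweak_has_sum compact_plus_scalars
      (\<lambda>j. bidual_embed compact_plus_scalars (adj y o\<^sub>L x j o\<^sub>L (adj (x j) o\<^sub>L y))) S J"
    and mem: "\<And>j. j \<in> J \<Longrightarrow> adj (x j) o\<^sub>L y \<in> compact_plus_scalars"
    and cl: "\<And>j. j \<in> J \<Longrightarrow> clinear_op (x j)" "clinear_op y"
  shows "countable {j \<in> J. adj (x j) (y v) \<noteq> 0}"
proof -
  let ?A = compact_plus_scalars
  define \<phi> where "\<phi> = cutoff ?A (\<lambda>a. cinner v (a v))"
  let ?f = "\<lambda>j. bidual_embed ?A (adj y o\<^sub>L x j o\<^sub>L (adj (x j) o\<^sub>L y)) \<phi>"
  have \<phi>: "\<phi> \<in> dual ?A" unfolding \<phi>_def by (rule vector_functional_in_dual)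
  have val: "?f j = complex_of_real ((norm (adj (x j) (y v)))\<^sup>2)" if j: "j \<in> J" for j
  proof -
    let ?z = "adj (x j) o\<^sub>L y"
    have z: "adj ?z = adj y o\<^sub>L x j"
      using cl j by (simp add: adj_comp clinear_adj adj_adj)
    have "adj ?z o\<^sub>L ?z \<in> ?A"
      by (rule cps_comp[OF conjunct1[OF cps_adj_scalar_part[OF mem[OF j]]] mem[OF j]])
    then have "?f j = cinner v (adj ?z (?z v))"
      unfolding z bidual_embed_def cutoff_def[of "dual ?A"] \<phi>_def[symmetric]
      using \<phi> by (simp add: \<phi>_def cutoff_def)
    also have "\<dots> = cinner (?z v) (?z v)"
      using cl j by (intro cinner_adj_right clinear_op_comp clinear_adj)
    finally show ?thesis by (simp add: cinner_self)
  qed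
  have "?f summable_on J"
    using S \<phi> unfolding ultraweak_has_sum_def by (intro has_sum_imp_summable) blast
  from summable_countable_complex[OF this]
  have "countable {j \<in> J. ?f j \<noteq> 0}" .
  moreover have "{j \<in> J. ?f j \<noteq> 0} = {j \<in> J. adj (x j) (y v) \<noteq> 0}"
    using val by (intro Collect_cong conj_cong refl) simp
  ultimately show ?thesis by simp
qed

lemma uncountable_nat_sets: "uncountable (UNIV :: nat set set)"
  using Cantors_theorem[of "UNIV :: nat set"] unfolding uncountable_def by simp

text \<open>Vector states live on a separable space, which leaves only countably many members of a frame
  nonzero. The character sees a Hilbert space with an orthonormal family indexed by all branches,
  which a countable family cannot span: some branch is orthogonal to all members of the frame, and
  the lower frame bound fails there.\<close>

lemma no_frame_branch_module: "\<not> is_frame compact_plus_scalars branch_module J x"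
proof
  let ?A = compact_plus_scalars
  assume "is_frame ?A branch_module J x"
  then have "(\<forall>j\<in>J. x j \<in> closure branch_span) \<and> (\<exists>C>0. \<exists>D>0. \<forall>y\<in>closure branch_span. \<exists>S.
        ultraweak_has_sum ?A (\<lambda>j. bidual_embed ?A (adj y o\<^sub>L x j o\<^sub>L (adj (x j) o\<^sub>L y))) S J \<and>
        bidual_le ?A (\<lambda>\<phi>. complex_of_real C * bidual_embed ?A (adj y o\<^sub>L y) \<phi>) S \<and>
        bidual_le ?A S (\<lambda>\<phi>. complex_of_real D * bidual_embed ?A (adj y o\<^sub>L y) \<phi>))"
    unfolding is_frame_def branch_module_def hilbert_structure.simps .
  then obtain C D where "\<forall>j\<in>J. x j \<in> closure branch_span" and C: "C > 0"
    and "\<forall>y\<in>closure branch_span. \<exists>S.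
        ultraweak_has_sum ?A (\<lambda>j. bidual_embed ?A (adj y o\<^sub>L x j o\<^sub>L (adj (x j) o\<^sub>L y))) S J \<and>
        bidual_le ?A (\<lambda>\<phi>. complex_of_real C * bidual_embed ?A (adj y o\<^sub>L y) \<phi>) S \<and>
        bidual_le ?A S (\<lambda>\<phi>. complex_of_real D * bidual_embed ?A (adj y o\<^sub>L y) \<phi>)"
    by (elim conjE exE)
  note x = bspec[OF this(1)] and frame = bspec[OF this(3)]
  note cl = clinear_branch_module[OF x]
  \<comment> \<open>A rank-one operator moves a fixed unit vector to any other one, so its frame sum tests the
    \<open>n\<close>-th rows of all members at once. It belongs to the module because all compact operators do.\<close>
  have row: "countable {j \<in> J. adj (x j) (unit_vec n) \<noteq> 0}" for n
  proof -
    let ?y = "rank_one (unit_vec n) (unit_vec 0)"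
    have y: "?y \<in> closure branch_span"
      by (intro subsetD[OF closure_subset] branch_span.compact compact_op_rank_one)
    obtain S where S: "ultraweak_has_sum ?A
        (\<lambda>j. bidual_embed ?A (adj ?y o\<^sub>L x j o\<^sub>L (adj (x j) o\<^sub>L ?y))) S J"
      using frame[OF y] by (elim exE conjE)
    have "?y (unit_vec 0) = unit_vec n"
      by (simp add: rank_one.rep_eq cinner_unit_vec coord_unit_vec cscale_1)
    then show ?thesis
      using ultraweak_sum_countable[OF S branch_module_inner[OF x y] cl clinear_branch_module[OF y],
          of "unit_vec 0"] by simp
  qed
  have rows_zero: "x j = 0" if "\<forall>n. adj (x j) (unit_vec n) = 0" and j: "j \<in> J" for j
  proof (rule blinfun_eqI, rule coord_inject[THEN iffD1], rule ext)
    fix v n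
    have "coord (x j v) n = cinner (adj (x j) (unit_vec n)) v"
      by (simp only: cinner_adj[OF cl[OF j]] cinner_unit_vec)
    also have "\<dots> = coord ((0 :: l2 \<Rightarrow>\<^sub>L l2) v) n"
      by (simp add: that(1) cinner_def zero_l2.rep_eq)
    finally show "coord (x j v) n = coord ((0 :: l2 \<Rightarrow>\<^sub>L l2) v) n" .
  qed
  have "{j \<in> J. x j \<noteq> 0} \<subseteq> (\<Union>n. {j \<in> J. adj (x j) (unit_vec n) \<noteq> 0})"
  proof
    fix j assume j: "j \<in> {j \<in> J. x j \<noteq> 0}"
    then obtain n where "adj (x j) (unit_vec n) \<noteq> 0" using rows_zero[of j] by blast
    then show "j \<in> (\<Union>n. {j \<in> J. adj (x j) (unit_vec n) \<noteq> 0})" using j by blast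
  qed
  then have J0: "countable {j \<in> J. x j \<noteq> 0}"
    by (rule countable_subset) (rule countable_UN[OF countableI_type row])
  let ?c = "\<lambda>t j. scalar_part (adj (branch_isometry t) o\<^sub>L x j)"
  have bad: "countable (\<Union>j\<in>{j \<in> J. x j \<noteq> 0}. {t. ?c t j \<noteq> 0})"
    using x by (intro countable_UN[OF J0] countable_branch_coefficients) simp
  obtain t where t: "t \<notin> (\<Union>j\<in>{j \<in> J. x j \<noteq> 0}. {t. ?c t j \<noteq> 0})"
  proof (rule ccontr)
    assume "\<not> thesis"
    have "t \<in> (\<Union>j\<in>{j \<in> J. x j \<noteq> 0}. {t. ?c t j \<noteq> 0})" for t
      by (rule ccontr) (rule notE[OF \<open>\<not> thesis\<close> that])
    then have "UNIV = (\<Union>j\<in>{j \<in> J. x j \<noteq> 0}. {t. ?c t j \<noteq> 0})" by (rule UNIV_eq_I)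
    then show False using bad uncountable_nat_sets by (metis (lifting))
  qed
  have zero: "?c t j = 0" if j: "j \<in> J" for j
  proof (cases "x j = 0")
    case True
    then have "adj (branch_isometry t) o\<^sub>L x j = 0" by (intro blinfun_eqI) simp
    then show ?thesis by (simp add: scalar_part_compact compact_op_0)
  next
    case False
    then show ?thesis using t j by blast
  qed
  \<comment> \<open>At the character the frame sum of the isometry along \<open>t\<close> vanishes while its inner square is \<open>1\<close>,
    so the lower bound would make \<open>- C\<close> a square.\<close>
  let ?V = "branch_isometry t"
  note V = branch_isometry_in_module[of t]
  obtain S where S: "ultraweak_has_sum ?A
      (\<lambda>j. bidual_embed ?A (adj ?V o\<^sub>L x j o\<^sub>L (adj (x j) o\<^sub>L ?V))) S J"
    and le: "bidual_le ?A (\<lambda>\<phi>. complex_of_real C * bidual_embed ?A (adj ?V o\<^sub>L ?V) \<phi>) S"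
    using frame[OF V] by (elim exE conjE)
  have "bidual_embed ?A (adj ?V o\<^sub>L x j o\<^sub>L (adj (x j) o\<^sub>L ?V)) character = 0" if j: "j \<in> J" for j
  proof -
    note mem = branch_module_inner[OF V x[OF j]] branch_module_inner[OF x[OF j] V]
    have "scalar_part (adj ?V o\<^sub>L x j o\<^sub>L (adj (x j) o\<^sub>L ?V)) = 0"
      by (simp add: scalar_part_comp[OF mem] zero[OF j])
    then show ?thesis
      by (simp add: bidual_embed_def cutoff_def character_in_dual character_apply cps_comp[OF mem])
  qed
  then have "((\<lambda>j. bidual_embed ?A (adj ?V o\<^sub>L x j o\<^sub>L (adj (x j) o\<^sub>L ?V)) character) has_sum 0) J"
    by (rule has_sum_0)
  moreover have "((\<lambda>j. bidual_embed ?A (adj ?V o\<^sub>L x j o\<^sub>L (adj (x j) o\<^sub>L ?V)) character)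
      has_sum S character) J"
    using S unfolding ultraweak_has_sum_def by (intro bspec[OF conjunct2 character_in_dual])
  ultimately have S0: "S character = 0" by (rule has_sum_unique[rotated])
  obtain R where R: "R \<in> bidual ?A"
    and eq: "(\<lambda>\<phi>. S \<phi> - complex_of_real C * bidual_embed ?A (adj ?V o\<^sub>L ?V) \<phi>) =
      bidual_mult ?A (bidual_star ?A R) R"
    using le unfolding bidual_le_def by (elim bexE)
  have "bidual_embed ?A (adj ?V o\<^sub>L ?V) character = 1"
    unfolding branch_product_same
    by (simp add: bidual_embed_def cutoff_def character_in_dual character_apply scalar_in_cps
        scalar_part_scalar)
  then have "complex_of_real (- C) = complex_of_real ((cmod (R character))\<^sup>2)"
    using fun_cong[OF eq, of character] by (simp add: S0 character_Arens_square[OF R])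
  then have "- C = (cmod (R character))\<^sup>2" unfolding of_real_eq_iff .
  then show False using C zero_le_power2[of "cmod (R character)"] by linarith
qed

theorem corollary4p2:
  shows "\<exists>X :: (l2 \<Rightarrow>\<^sub>L l2) hilbert_structure.
    hilbert_module compact_plus_scalars X \<and> \<not> possesses_frame compact_plus_scalars X"
  using hilbert_module_branch_module no_frame_branch_module unfolding possesses_frame_def by blast

end
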